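(* A class of objects of a cardinal category is a skeleton iff it is a skeletoid with ($*$AP).
   Context: For a category $\mathscr C$, $\mathsf{Ob}(\mathscr C)$ is its class of objects, $\mathsf{Mor}_{\mathscr C}(X,Y)$ the arrows from $X$ to $Y$, $\mathrm{Aut}_{\mathscr C}(X)$ the automorphism group of $X$. An arrow $u\in\mathsf{Mor}_{\mathscr C}(X,Y)$ is a monomorphism if $u\circ v=u\circ w$ implies $v=w$ for all arrows $v,w$ with codomain $X$ and common domain. $X\prec_{\mathscr C}Y$ means $\mathsf{Mor}_{\mathscr C}(X,Y)\neq\varnothing$. An object $X$ is absolutely homogeneous (AB-HO) if for any object $A$ and any arrows $u,v\in\mathsf{Mor}_{\mathscr C}(A,X)$ there is $\phi\in\mathrm{Aut}_{\mathscr C}(X)$ with $v=\phi\circ u$. A class $\mathcal E$ of objects is closed under isomorphic copies if it contains every object isomorphic to a member of it; it is proper if there is a set $W$ of objects such that any object from $\mathcal E$ is isomorphic to an object from $W$. A category $\mathscr C$ is cardinal if: (Arr) all arrows in $\mathscr C$ are monomorphisms and $\mathsf{Mor}_{\mathscr C}(X,Y)$ is a set for any objects $X,Y$; (Sys) all direct systems in $\mathscr C$ have (direct) limits; (Card) to any object $X$ there is assigned a cardinal number, called the size of $X$ and denoted $|X|$, so that isomorphic objects have the same size; (Lim) any object with infinite size $\alpha$ is isomorphic to the object of the direct limit of some direct system consisting of at most $\alpha$ objects each of which has finite size; (Size) if a direct system consists of $\alpha\geq\aleph_0$ objects each of which has finite size, then the object of its direct limit has size not greater than $\alpha$; (Dir)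 if $X,Y$ are objects of finite size, $Z$ is an object, and $u\in\mathsf{Mor}_{\mathscr C}(X,Z)$, $v\in\mathsf{Mor}_{\mathscr C}(Y,Z)$ are arbitrary, then there exist an object $W$ of finite size and arrows $\alpha\in\mathsf{Mor}_{\mathscr C}(X,W)$, $\beta\in\mathsf{Mor}_{\mathscr C}(Y,W)$, $\gamma\in\mathsf{Mor}_{\mathscr C}(W,Z)$ with $u=\gamma\circ\alpha$ and $v=\gamma\circ\beta$; (Fin) for any object $X$ the class $\mathrm{Fin}_{\mathscr C}(X)$ of all objects $A$ of finite size such that $A\prec_{\mathscr C}X$ is proper; (Upp) for any object $X$ there is a cardinal $\mathfrak m$ such that $|Y|\leq\mathfrak m$ for every object $Y$ with $Y\prec_{\mathscr C}X$; (Emb) any object $X$ of finite size has the property: whenever a direct system $\langle Z_\alpha,p_{\alpha,\beta}\rangle_{\alpha\leq\beta}$ in $\mathscr C$ is such that the object $W$ of its direct limit satisfies $X\prec_{\mathscr C}W$, then $X\prec_{\mathscr C}Z_\alpha$ for some index $\alpha$. In a cardinal category, a finitary structure is a class $\mathcal F$ of objects of finite size that is closed under isomorphic copies and such that $X\in\mathcal F$ whenever $X$ has finite size, $X\prec_{\mathscr C}Y$ and $Y\in\mathcal F$. $\langle\mathcal F\rangle$ is the class of all objects $X$ such that every object $A$ of finite size with $A\prec_{\mathscr C}X$ belongs to $\mathcal F$. A class $\mathcal E$ of objects has (AP) (the amalgamation property) in $\mathscr C$ if: (1) whenever $X,Y,Z\in\mathcal E$ and $u\colon X\to Y$, $v\colon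 X\to Z$ are arrows of $\mathscr C$, there exist $W\in\mathcal E$ and arrows $p\colon Y\to W$, $q\colon Z\to W$ of $\mathscr C$ with $p\circ u=q\circ v$; and (2) for any $X,Y\in\mathcal E$ there is $Z\in\mathcal E$ with $X\prec_{\mathscr C}Z$ and $Y\prec_{\mathscr C}Z$. A finitary structure $\mathcal F$ has ($*$AP) if $\langle\mathcal F\rangle$ has (AP). A finitary structure $\mathcal F$ satisfies (SBP) (size boundedness principle) if there is a cardinal $\mathfrak m$ such that $|X|\leq\mathfrak m$ for any $X\in\langle\mathcal F\rangle$. A skeletoid in $\mathscr C$ is a proper finitary structure that satisfies (SBP) and has (AP). A skeleton in $\mathscr C$ is a class of the form $\mathrm{Fin}_{\mathscr C}(X)$ for some AB-HO object $X$ of $\mathscr C$.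
   Formalization: The class is assumed nonempty: the empty class is vacuously a skeletoid with ( *AP), but a skeleton Fin(X) is never empty (index sets of direct systems being nonempty), so the literal equivalence fails for the empty class. *)

theory Defs
  imports Main
begin

unbundle cardinal_syntax

text \<open>
  Sets and classes.  The universe of sets is modelled by a type \<open>'u\<close> whose cardinality is
  strongly inaccessible.  Arbitrary HOL sets play the role of classes, and those of
  cardinality less than \<open>|UNIV :: 'u set|\<close> play the role of sets.  Every such small set
  is equipotent to a subset of \<open>'u\<close>, so it is enough to take index sets of direct systems
  in \<open>'u\<close>.  The cardinal numbers are the cardinal orders below \<open>|UNIV :: 'u set|\<close>,
  compared by \<open>\<le>o\<close> and identified along \<open>=o\<close>.
\<close>

definition inaccessible_universe :: "'u itself \<Rightarrow> bool" where
  "inaccessible_universe _ \<longleftrightarrow>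
     natLeq <o |UNIV :: 'u set| \<and>
     regularCard |UNIV :: 'u set| \<and>
     (\<forall>A :: 'u set. |A| <o |UNIV :: 'u set| \<longrightarrow> |Pow A| <o |UNIV :: 'u set| )"

definition small :: "'u itself \<Rightarrow> 'a set \<Rightarrow> bool" where
  "small _ A \<longleftrightarrow> |A| <o |UNIV :: 'u set|"

definition cardinal_number :: "'u rel \<Rightarrow> bool" where
  "cardinal_number r \<longleftrightarrow> Card_order r \<and> r <o |UNIV :: 'u set|"

definition finite_cardinal :: "'u rel \<Rightarrow> bool" where
  "finite_cardinal r \<longleftrightarrow> finite (Field r)"


record ('o, 'm) category =
  obj :: "'o set"
  arr :: "'m set"
  dom :: "'m \<Rightarrow> 'o"
  cod :: "'m \<Rightarrow> 'o"
  ident :: "'o \<Rightarrow> 'm"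
  comp :: "'m \<Rightarrow> 'm \<Rightarrow> 'm"  (infixl \<open>\<cdot>\<index>\<close> 70)

definition Mor :: "('o, 'm, 'z) category_scheme \<Rightarrow> 'o \<Rightarrow> 'o \<Rightarrow> 'm set" where
  "Mor C X Y = {u \<in> arr C. dom C u = X \<and> cod C u = Y}"

locale category =
  fixes C :: "('o, 'm, 'z) category_scheme" (structure)
  assumes dom_obj: "u \<in> arr C \<Longrightarrow> dom C u \<in> obj C"
    and cod_obj: "u \<in> arr C \<Longrightarrow> cod C u \<in> obj C"
    and ident_Mor: "X \<in> obj C \<Longrightarrow> ident C X \<in> Mor C X X"
    and comp_Mor: "u \<in> Mor C X Y \<Longrightarrow> v \<in> Mor C Y Z \<Longrightarrow> v \<cdot> u \<in> Mor C X Z"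
    and comp_assoc: "u \<in> Mor C X Y \<Longrightarrow> v \<in> Mor C Y Z \<Longrightarrow> w \<in> Mor C Z W
      \<Longrightarrow> w \<cdot> (v \<cdot> u) = (w \<cdot> v) \<cdot> u"
    and ident_right: "u \<in> Mor C X Y \<Longrightarrow> u \<cdot> ident C X = u"
    and ident_left: "u \<in> Mor C X Y \<Longrightarrow> ident C Y \<cdot> u = u"

definition monomorphism :: "('o, 'm, 'z) category_scheme \<Rightarrow> 'm \<Rightarrow> bool" where
  "monomorphism C u \<longleftrightarrow> u \<in> arr C \<and>
     (\<forall>A. \<forall>v \<in> Mor C A (dom C u). \<forall>w \<in> Mor C A (dom C u).
        u \<cdot>\<^bsub>C\<^esub> v = u \<cdot>\<^bsub>C\<^esub> w \<longrightarrow> v = w)"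

definition isomorphisms :: "('o, 'm, 'z) category_scheme \<Rightarrow> 'o \<Rightarrow> 'o \<Rightarrow> 'm set" where
  "isomorphisms C X Y =
     {u \<in> Mor C X Y. \<exists>v \<in> Mor C Y X. v \<cdot>\<^bsub>C\<^esub> u = ident C X \<and> u \<cdot>\<^bsub>C\<^esub> v = ident C Y}"

definition Aut :: "('o, 'm, 'z) category_scheme \<Rightarrow> 'o \<Rightarrow> 'm set" where
  "Aut C X = isomorphisms C X X"

definition isomorphic :: "('o, 'm, 'z) category_scheme \<Rightarrow> 'o \<Rightarrow> 'o \<Rightarrow> bool" where
  "isomorphic C X Y \<longleftrightarrow> isomorphisms C X Y \<noteq> {}"

definition prec :: "('o, 'm, 'z) category_scheme \<Rightarrow> 'o \<Rightarrow> 'o \<Rightarrow> bool" where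
  "prec C X Y \<longleftrightarrow> Mor C X Y \<noteq> {}"

definition AB_HO :: "('o, 'm, 'z) category_scheme \<Rightarrow> 'o \<Rightarrow> bool" where
  "AB_HO C X \<longleftrightarrow> X \<in> obj C \<and>
     (\<forall>A \<in> obj C. \<forall>u \<in> Mor C A X. \<forall>v \<in> Mor C A X. \<exists>\<phi> \<in> Aut C X. v = \<phi> \<cdot>\<^bsub>C\<^esub> u)"

definition closed_under_iso :: "('o, 'm, 'z) category_scheme \<Rightarrow> 'o set \<Rightarrow> bool" where
  "closed_under_iso C E \<longleftrightarrow> (\<forall>X \<in> E. \<forall>Y \<in> obj C. isomorphic C X Y \<longrightarrow> Y \<in> E)"


text \<open>Directed sets are small and, as usual, nonempty; \<open>(a, b) \<in> R\<close> means \<open>a \<le> b\<close>.\<close>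

definition directed_set :: "'u set \<Rightarrow> 'u rel \<Rightarrow> bool" where
  "directed_set I R \<longleftrightarrow> small TYPE('u) I \<and> I \<noteq> {} \<and> preorder_on I R \<and>
     (\<forall>a \<in> I. \<forall>b \<in> I. \<exists>c \<in> I. (a, c) \<in> R \<and> (b, c) \<in> R)"

definition direct_system ::
  "('o, 'm, 'z) category_scheme \<Rightarrow> 'u set \<Rightarrow> 'u rel \<Rightarrow> ('u \<Rightarrow> 'o) \<Rightarrow> ('u \<Rightarrow> 'u \<Rightarrow> 'm) \<Rightarrow> bool"
where
  "direct_system C I R Z p \<longleftrightarrow> directed_set I R \<and>
     (\<forall>a \<in> I. Z a \<in> obj C) \<and>
     (\<forall>a b. (a, b) \<in> R \<longrightarrow> p a b \<in> Mor C (Z a) (Z b)) \<and>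
     (\<forall>a \<in> I. p a a = ident C (Z a)) \<and>
     (\<forall>a b c. (a, b) \<in> R \<longrightarrow> (b, c) \<in> R \<longrightarrow> p b c \<cdot>\<^bsub>C\<^esub> p a b = p a c)"

definition cocone ::
  "('o, 'm, 'z) category_scheme \<Rightarrow> 'u set \<Rightarrow> 'u rel \<Rightarrow> ('u \<Rightarrow> 'o) \<Rightarrow> ('u \<Rightarrow> 'u \<Rightarrow> 'm)
     \<Rightarrow> 'o \<Rightarrow> ('u \<Rightarrow> 'm) \<Rightarrow> bool"
where
  "cocone C I R Z p W q \<longleftrightarrow> W \<in> obj C \<and>
     (\<forall>a \<in> I. q a \<in> Mor C (Z a) W) \<and>
     (\<forall>a b. (a, b) \<in> R \<longrightarrow> q b \<cdot>\<^bsub>C\<^esub> p a b = q a)"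

definition direct_limit ::
  "('o, 'm, 'z) category_scheme \<Rightarrow> 'u set \<Rightarrow> 'u rel \<Rightarrow> ('u \<Rightarrow> 'o) \<Rightarrow> ('u \<Rightarrow> 'u \<Rightarrow> 'm)
     \<Rightarrow> 'o \<Rightarrow> ('u \<Rightarrow> 'm) \<Rightarrow> bool"
where
  "direct_limit C I R Z p W q \<longleftrightarrow> cocone C I R Z p W q \<and>
     (\<forall>Y f. cocone C I R Z p Y f \<longrightarrow>
        (\<exists>!h. h \<in> Mor C W Y \<and> (\<forall>a \<in> I. h \<cdot>\<^bsub>C\<^esub> q a = f a)))"


record ('o, 'm, 'u) sized_category = "('o, 'm) category" +
  osize :: "'o \<Rightarrow> 'u rel"

definition fin_size :: "('o, 'm, 'u, 'z) sized_category_scheme \<Rightarrow> 'o \<Rightarrow> bool" where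
  "fin_size C X \<longleftrightarrow> X \<in> obj C \<and> finite_cardinal (osize C X)"

definition Fin :: "('o, 'm, 'u, 'z) sized_category_scheme \<Rightarrow> 'o \<Rightarrow> 'o set" where
  "Fin C X = {A. fin_size C A \<and> prec C A X}"

definition proper :: "('o, 'm, 'u, 'z) sized_category_scheme \<Rightarrow> 'o set \<Rightarrow> bool" where
  "proper C E \<longleftrightarrow> (\<exists>W \<subseteq> obj C. small TYPE('u) W \<and> (\<forall>X \<in> E. \<exists>Y \<in> W. isomorphic C X Y))"

locale cardinal_category = category C
  for C :: "('o, 'm, 'u, 'z) sized_category_scheme" (structure) +
  assumes Arr_mono: "u \<in> arr C \<Longrightarrow> monomorphism C u"
    and Arr_set: "X \<in> obj C \<Longrightarrow> Y \<in> obj C \<Longrightarrow> small TYPE('u) (Mor C X Y)"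
    and Sys: "\<And>(I :: 'u set) R Z p. direct_system C I R Z p
      \<Longrightarrow> \<exists>W q. direct_limit C I R Z p W q"
    and Card: "X \<in> obj C \<Longrightarrow> cardinal_number (osize C X)"
    and Card_iso: "X \<in> obj C \<Longrightarrow> Y \<in> obj C \<Longrightarrow> isomorphic C X Y \<Longrightarrow> osize C X =o osize C Y"
    and Lim: "X \<in> obj C \<Longrightarrow> \<not> finite_cardinal (osize C X) \<Longrightarrow>
      \<exists>(I :: 'u set) R Z p W q. direct_system C I R Z p \<and> |I| \<le>o osize C X \<and>
        (\<forall>a \<in> I. fin_size C (Z a)) \<and> direct_limit C I R Z p W q \<and> isomorphic C X W"
    and Size: "\<And>(I :: 'u set) R Z p W q. direct_system C I R Z p \<Longrightarrow> infinite I \<Longrightarrow>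
      (\<forall>a \<in> I. fin_size C (Z a)) \<Longrightarrow> direct_limit C I R Z p W q \<Longrightarrow> osize C W \<le>o |I|"
    and Dir: "fin_size C X \<Longrightarrow> fin_size C Y \<Longrightarrow> Z \<in> obj C \<Longrightarrow>
      u \<in> Mor C X Z \<Longrightarrow> v \<in> Mor C Y Z \<Longrightarrow>
      \<exists>W. fin_size C W \<and> (\<exists>\<alpha> \<in> Mor C X W. \<exists>\<beta> \<in> Mor C Y W. \<exists>\<gamma> \<in> Mor C W Z.
        u = \<gamma> \<cdot> \<alpha> \<and> v = \<gamma> \<cdot> \<beta>)"
    and Fin: "X \<in> obj C \<Longrightarrow> proper C (Fin C X)"
    and Upp: "X \<in> obj C \<Longrightarrow>
      \<exists>\<mm> :: 'u rel. cardinal_number \<mm> \<and> (\<forall>Y \<in> obj C. prec C Y X \<longrightarrow> osize C Y \<le>o \<mm>)"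
    and Emb: "\<And>X (I :: 'u set) R Z p W q. fin_size C X \<Longrightarrow> direct_system C I R Z p \<Longrightarrow>
      direct_limit C I R Z p W q \<Longrightarrow> prec C X W \<Longrightarrow> \<exists>a \<in> I. prec C X (Z a)"


definition finitary_structure :: "('o, 'm, 'u, 'z) sized_category_scheme \<Rightarrow> 'o set \<Rightarrow> bool" where
  "finitary_structure C F \<longleftrightarrow> (\<forall>X \<in> F. fin_size C X) \<and> closed_under_iso C F \<and>
     (\<forall>X Y. fin_size C X \<longrightarrow> prec C X Y \<longrightarrow> Y \<in> F \<longrightarrow> X \<in> F)"

definition generated :: "('o, 'm, 'u, 'z) sized_category_scheme \<Rightarrow> 'o set \<Rightarrow> 'o set" where
  "generated C F = {X \<in> obj C. \<forall>A. fin_size C A \<longrightarrow> prec C A X \<longrightarrow> A \<in> F}"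

definition AP :: "('o, 'm, 'z) category_scheme \<Rightarrow> 'o set \<Rightarrow> bool" where
  "AP C E \<longleftrightarrow>
     (\<forall>X \<in> E. \<forall>Y \<in> E. \<forall>Z \<in> E. \<forall>u \<in> Mor C X Y. \<forall>v \<in> Mor C X Z.
        \<exists>W \<in> E. \<exists>p \<in> Mor C Y W. \<exists>q \<in> Mor C Z W. p \<cdot>\<^bsub>C\<^esub> u = q \<cdot>\<^bsub>C\<^esub> v) \<and>
     (\<forall>X \<in> E. \<forall>Y \<in> E. \<exists>Z \<in> E. prec C X Z \<and> prec C Y Z)"

definition star_AP :: "('o, 'm, 'u, 'z) sized_category_scheme \<Rightarrow> 'o set \<Rightarrow> bool" where
  "star_AP C F \<longleftrightarrow> AP C (generated C F)"

definition SBP :: "('o, 'm, 'u, 'z) sized_category_scheme \<Rightarrow> 'o set \<Rightarrow> bool" where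
  "SBP C F \<longleftrightarrow> (\<exists>\<mm> :: 'u rel. cardinal_number \<mm> \<and> (\<forall>X \<in> generated C F. osize C X \<le>o \<mm>))"

definition skeletoid :: "('o, 'm, 'u, 'z) sized_category_scheme \<Rightarrow> 'o set \<Rightarrow> bool" where
  "skeletoid C F \<longleftrightarrow> finitary_structure C F \<and> proper C F \<and> SBP C F \<and> AP C F"

definition skeleton :: "('o, 'm, 'u, 'z) sized_category_scheme \<Rightarrow> 'o set \<Rightarrow> bool" where
  "skeleton C E \<longleftrightarrow> (\<exists>X \<in> obj C. AB_HO C X \<and> E = Fin C X)"

text \<open>
  The empty class is vacuously a skeletoid with the property \<open>star_AP\<close>, but a skeleton is
  never empty.  The characterisation of skeletons is therefore about nonempty classes.
\<close>

lemma (in cardinal_category) Fin_nonempty: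
  assumes X: "X \<in> obj C"
  shows "Fin C X \<noteq> {}"
proof (cases "finite_cardinal (osize C X)")
  case True
  then have "X \<in> Fin C X"
    using X ident_Mor[OF X] by (auto simp: Fin_def fin_size_def prec_def)
  then show ?thesis by blast
next
  case False
  from Lim[OF X False] obtain I :: "'u set" and R Z p W q where
    sys: "direct_system C I R Z p" and fin: "\<forall>a \<in> I. fin_size C (Z a)"
    and lim: "direct_limit C I R Z p W q" and iso: "isomorphic C X W" by blast
  obtain a where a: "a \<in> I"
    using sys by (auto simp: direct_system_def directed_set_def)
  have q: "q a \<in> Mor C (Z a) W"
    using lim a by (auto simp: direct_limit_def cocone_def)
  obtain v where "v \<in> Mor C W X"
    using iso by (auto simp: isomorphic_def isomorphisms_def)
  then have "v \<cdot> q a \<in> Mor C (Z a) X" using q comp_Mor by blast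
  then have "Z a \<in> Fin C X" using fin a by (auto simp: Fin_def prec_def)
  then show ?thesis by blast
qed

lemma (in cardinal_category) skeleton_nonempty: "skeleton C E \<Longrightarrow> E \<noteq> {}"
  using Fin_nonempty by (auto simp: skeleton_def)

lemma (in cardinal_category) skeletoid_empty:
  shows "skeletoid C {}" and "star_AP C {}"
proof -
  have gen: "generated C {} = {}"
    using Fin_nonempty by (auto simp: generated_def Fin_def)
  have o: "|{} :: 'o set| <o |UNIV :: 'u set|" and u: "|{} :: 'u set| <o |UNIV :: 'u set|"
    by (auto simp flip: not_ordLeq_iff_ordLess[OF card_of_Well_order card_of_Well_order]
        dest: card_of_empty3)
  have "proper C {}"
    unfolding proper_def small_def by (rule exI[of _ "{}"]) (auto simp: o)
  moreover have "SBP C {}"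
    unfolding SBP_def gen cardinal_number_def
    by (rule exI[of _ "|{} :: 'u set|"]) (auto simp: u card_of_Card_order)
  ultimately show "skeletoid C {}"
    by (auto simp: skeletoid_def finitary_structure_def closed_under_iso_def AP_def)
  show "star_AP C {}" by (simp add: star_AP_def gen AP_def)
qed

end

theory Submission
  imports Defs
begin

text \<open>
  Suppose first that \<open>E\<close> is a nonempty skeletoid whose generated class \<open>G\<close> has the amalgamation
  property.  An object of \<open>G\<close> lies in \<open>E\<close> or is a limit of members of \<open>E\<close> over an index set of
  bounded size, so \<open>G\<close> has only a small set of isomorphism types (\<open>generated_proper\<close>), and \<open>G\<close> is closed under
  direct limits.  Then \<open>G\<close> has an object \<open>X\<close> all of whose arrows into members of \<open>G\<close> are invertible
  (\<open>maximal_object_exists\<close>): without one, alternately adding a noninvertible arrow and passing to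
  limits would give chains of arbitrary small length, hence too many different arrows between
  representatives of the isomorphism types.  Amalgams over \<open>X\<close> are isomorphic to \<open>X\<close>, so the
  amalgamation property says that \<open>X\<close> is absolutely homogeneous and that every member of \<open>E\<close>
  embeds in \<open>X\<close>.

  Conversely, let \<open>X\<close> be absolutely homogeneous.  The main point is universality
  (\<open>AB_HO_universal\<close>): every object all of whose finite subobjects embed in \<open>X\<close> embeds in \<open>X\<close>.
  Unless it is finite, such an object is a limit of finite objects, and embeddings into \<open>X\<close> of sublimits are built by
  induction on the cardinality of the index set.  Homogeneity for objects of every size makes it
  possible to correct an embedding of a larger sublimit so that it prolongs a given embedding of
  a smaller one (\<open>AB_HO_extend_cocone\<close>), and coherent embeddings have a union.  Universality
  bounds the sizes in the generated class by the sizes of the objects below \<open>X\<close>, and makes \<open>X\<close>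
  an amalgam in that class.
\<close>

section \<open>Small sets\<close>

lemma small_subset: "small TYPE('u) B \<Longrightarrow> A \<subseteq> B \<Longrightarrow> small TYPE('u) A"
  unfolding small_def using card_of_mono1 ordLeq_ordLess_trans by blast

lemma small_image: "small TYPE('u) A \<Longrightarrow> small TYPE('u) (f ` A)"
  unfolding small_def using card_of_image ordLeq_ordLess_trans by blast

lemma small_inj_on: "inj_on f A \<Longrightarrow> small TYPE('u) (f ` A) \<Longrightarrow> small TYPE('u) A"
  by (drule small_image[where f = "inv_into A f"]) simp

lemma small_code: "small TYPE('u) A \<Longrightarrow> \<exists>e :: 'a \<Rightarrow> 'u. inj_on e A"
  unfolding small_def
  by (drule ordLess_imp_ordLeq) (unfold card_of_ordLeq[symmetric], blast)

lemma universe_infinite: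
  assumes "inaccessible_universe TYPE('u)"
  shows "infinite (UNIV :: 'u set)"
  using assms ordLess_imp_ordLeq[of natLeq "|UNIV :: 'u set|"] infinite_iff_natLeq_ordLeq
  unfolding inaccessible_universe_def by blast

lemma universe_stable:
  assumes "inaccessible_universe TYPE('u)"
  shows "stable |UNIV :: 'u set|"
proof (rule regularCard_stable[OF card_of_Card_order])
  show "infinite (Field |UNIV :: 'u set| )"
    using universe_infinite[OF assms] by (simp add: Field_card_of)
  show "regularCard |UNIV :: 'u set|"
    using assms by (simp add: inaccessible_universe_def)
qed

lemma small_Pow:
  assumes "inaccessible_universe TYPE('u)" and "small TYPE('u) A"
  shows "small TYPE('u) (Pow A)"
proof -
  obtain e :: "_ \<Rightarrow> 'u" where e: "inj_on e A"
    using small_code[OF assms(2)] by blast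
  have "small TYPE('u) (Pow (e ` A))"
    using assms(1) small_image[OF assms(2), of e]
    unfolding inaccessible_universe_def small_def by blast
  then have "small TYPE('u) ((`) e ` Pow A)"
    by (rule small_subset) auto
  then show ?thesis
    using small_inj_on inj_on_image_Pow[OF e] by blast
qed

lemma small_UNION:
  assumes "inaccessible_universe TYPE('u)" and "small TYPE('u) A"
    and "\<And>a. a \<in> A \<Longrightarrow> small TYPE('u) (B a)"
  shows "small TYPE('u) (\<Union>a \<in> A. B a)"
  using assms(2,3) unfolding small_def by (rule stable_UNION[OF universe_stable[OF assms(1)]])

lemma small_Times:
  assumes "inaccessible_universe TYPE('u)" and "small TYPE('u) A" and "small TYPE('u) B"
  shows "small TYPE('u) (A \<times> B)"
  using assms(2,3) unfolding small_def by (rule stable_elim[OF universe_stable[OF assms(1)]])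

lemma small_Un:
  assumes "inaccessible_universe TYPE('u)" and "small TYPE('u) A" and "small TYPE('u) B"
  shows "small TYPE('u) (A \<union> B)"
  using assms(2,3) unfolding small_def
  by (rule card_of_Un_ordLess_infinite[OF universe_infinite[OF assms(1)]])

text \<open>
  A small subset of the universe is bounded in the well-order of the universe, by regularity.
  Bounding a copy of the powerset of \<open>K\<close> gives an initial segment that is strictly larger
  than \<open>K\<close>, by Cantor's theorem.
\<close>

lemma initial_segments_unbounded:
  assumes univ: "inaccessible_universe TYPE('u)" and K: "small TYPE('u) K"
  shows "\<exists>a :: 'u. |K| <o |underS |UNIV :: 'u set| a|"
proof -
  let ?r = "|UNIV :: 'u set|"
  obtain e :: "_ \<Rightarrow> 'u" where e: "inj_on e (Pow K)"
    using small_code[OF small_Pow[OF univ K]] by blast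
  have chain: "relChain ?r (underS ?r)"
    unfolding relChain_def
  proof (intro allI impI)
    fix i j assume "(i, j) \<in> ?r"
    then show "underS ?r i \<subseteq> underS ?r j"
      using card_of_Well_order[of "UNIV :: 'u set"]
      unfolding well_order_on_def linear_order_on_def partial_order_on_def preorder_on_def
        trans_def antisym_def underS_def by blast
  qed
  have cover: "e ` Pow K \<subseteq> (\<Union>i \<in> Field ?r. underS ?r i)"
  proof
    fix x :: 'u assume "x \<in> e ` Pow K"
    show "x \<in> (\<Union>i \<in> Field ?r. underS ?r i)"
      using infinite_Card_order_limit[OF card_of_Card_order[of "UNIV :: 'u set"], of x]
        universe_infinite[OF univ]
      by (auto simp: Field_card_of underS_def)
  qed
  have "small TYPE('u) (e ` Pow K)"
    by (rule small_image[OF small_Pow[OF univ K]])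
  then obtain a where a: "e ` Pow K \<subseteq> underS ?r a"
    using regularCard_UNION[OF card_of_Card_order _ chain cover] univ
    unfolding inaccessible_universe_def small_def by blast
  have "|K| <o |Pow K|" by (rule card_of_Pow)
  also have "|Pow K| \<le>o |underS ?r a|"
    using e a card_of_ordLeq by blast
  finally show ?thesis by blast
qed

section \<open>Isomorphisms and direct limits\<close>

context category
begin

lemma Mor_obj: "u \<in> Mor C X Y \<Longrightarrow> X \<in> obj C \<and> Y \<in> obj C"
  using dom_obj cod_obj by (auto simp: Mor_def)

lemma isomorphismsI:
  "u \<in> Mor C X Y \<Longrightarrow> v \<in> Mor C Y X \<Longrightarrow> v \<cdot> u = ident C X \<Longrightarrow> u \<cdot> v = ident C Y
    \<Longrightarrow> u \<in> isomorphisms C X Y"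
  by (auto simp: isomorphisms_def)

lemma isomorphismsE:
  assumes "u \<in> isomorphisms C X Y"
  obtains v where "u \<in> Mor C X Y" "v \<in> Mor C Y X" "v \<in> isomorphisms C Y X"
    "v \<cdot> u = ident C X" "u \<cdot> v = ident C Y"
  using assms by (auto simp: isomorphisms_def)

lemma cancel_left_inverse:
  assumes "u \<in> Mor C X Y" "v \<in> Mor C Y X" "v \<cdot> u = ident C X" "t \<in> Mor C A X"
  shows "v \<cdot> (u \<cdot> t) = t"
  using assms comp_assoc ident_left by metis

lemma cancel_right_inverse:
  assumes "u \<in> Mor C X Y" "v \<in> Mor C Y X" "v \<cdot> u = ident C X" "t \<in> Mor C X A"
  shows "(t \<cdot> v) \<cdot> u = t"
  using assms comp_assoc ident_right by metis

lemma comp_isomorphisms: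
  assumes "u \<in> isomorphisms C X Y" "v \<in> isomorphisms C Y Z"
  shows "v \<cdot> u \<in> isomorphisms C X Z"
proof -
  obtain u' where u: "u \<in> Mor C X Y" "u' \<in> Mor C Y X" "u' \<cdot> u = ident C X" "u \<cdot> u' = ident C Y"
    using assms(1) by (rule isomorphismsE)
  obtain v' where v: "v \<in> Mor C Y Z" "v' \<in> Mor C Z Y" "v' \<cdot> v = ident C Y" "v \<cdot> v' = ident C Z"
    using assms(2) by (rule isomorphismsE)
  show ?thesis
  proof (rule isomorphismsI)
    show "v \<cdot> u \<in> Mor C X Z" "u' \<cdot> v' \<in> Mor C Z X"
      using u v comp_Mor by blast+
    show "(u' \<cdot> v') \<cdot> (v \<cdot> u) = ident C X"
      using comp_assoc[OF comp_Mor[OF u(1) v(1)] v(2) u(2)]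
        cancel_left_inverse[OF v(1) v(2) v(3) u(1)] u(3) by simp
    show "(v \<cdot> u) \<cdot> (u' \<cdot> v') = ident C Z"
      using comp_assoc[OF comp_Mor[OF v(2) u(2)] u(1) v(1)]
        cancel_left_inverse[OF u(2) u(1) u(4) v(2)] v(4) by simp
  qed
qed

lemma isomorphic_sym: "isomorphic C X Y \<Longrightarrow> isomorphic C Y X"
  by (auto simp: isomorphic_def elim: isomorphismsE)

lemma isomorphic_trans: "isomorphic C X Y \<Longrightarrow> isomorphic C Y Z \<Longrightarrow> isomorphic C X Z"
  unfolding isomorphic_def using comp_isomorphisms by (metis all_not_in_conv)

lemma prec_refl: "X \<in> obj C \<Longrightarrow> prec C X X"
  using ident_Mor by (auto simp: prec_def)

lemma prec_trans: "prec C X Y \<Longrightarrow> prec C Y Z \<Longrightarrow> prec C X Z"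
  unfolding prec_def using comp_Mor by (metis all_not_in_conv)

lemma isomorphic_imp_prec: "isomorphic C X Y \<Longrightarrow> prec C X Y"
  by (auto simp: isomorphic_def isomorphisms_def prec_def)

lemma cocone_comp:
  assumes "R \<subseteq> I \<times> I" and "\<And>a b. (a, b) \<in> R \<Longrightarrow> p a b \<in> Mor C (Z a) (Z b)"
    and "cocone C I R Z p W q" and "h \<in> Mor C W Y"
  shows "cocone C I R Z p Y (\<lambda>a. h \<cdot> q a)"
  unfolding cocone_def
proof (intro conjI ballI allI impI)
  show "Y \<in> obj C" using Mor_obj assms(4) by blast
  show "h \<cdot> q a \<in> Mor C (Z a) Y" if "a \<in> I" for a
    using that assms(3,4) comp_Mor unfolding cocone_def by blast
  show "(h \<cdot> q b) \<cdot> p a b = h \<cdot> q a" if "(a, b) \<in> R" for a b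
  proof -
    have "b \<in> I" using that assms(1) by blast
    then have "q b \<in> Mor C (Z b) W" and "q b \<cdot> p a b = q a"
      using that assms(3) unfolding cocone_def by blast+
    then show ?thesis using comp_assoc[OF assms(2)[OF that] _ assms(4)] by metis
  qed
qed

lemma direct_limit_arrow_eqI:
  assumes "R \<subseteq> I \<times> I" and "\<And>a b. (a, b) \<in> R \<Longrightarrow> p a b \<in> Mor C (Z a) (Z b)"
    and lim: "direct_limit C I R Z p W q" and "h \<in> Mor C W Y" "k \<in> Mor C W Y"
    and "\<And>a. a \<in> I \<Longrightarrow> h \<cdot> q a = k \<cdot> q a"
  shows "h = k"
proof -
  have "cocone C I R Z p Y (\<lambda>a. k \<cdot> q a)"
    using cocone_comp assms unfolding direct_limit_def by blast
  then have "\<exists>!h. h \<in> Mor C W Y \<and> (\<forall>a \<in> I. h \<cdot> q a = k \<cdot> q a)"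
    using lim unfolding direct_limit_def by blast
  then show ?thesis using assms by blast
qed

lemma direct_limit_unique:
  assumes RI: "R \<subseteq> I \<times> I" and p: "\<And>a b. (a, b) \<in> R \<Longrightarrow> p a b \<in> Mor C (Z a) (Z b)"
    and lim: "direct_limit C I R Z p W q" and lim': "direct_limit C I R Z p W' q'"
  shows "isomorphic C W W'"
proof -
  have co: "cocone C I R Z p W q" and co': "cocone C I R Z p W' q'"
    using lim lim' by (auto simp: direct_limit_def)
  obtain h where h: "h \<in> Mor C W W'" "\<And>a. a \<in> I \<Longrightarrow> h \<cdot> q a = q' a"
    using lim co' unfolding direct_limit_def by metis
  obtain k where k: "k \<in> Mor C W' W" "\<And>a. a \<in> I \<Longrightarrow> k \<cdot> q' a = q a"
    using lim' co unfolding direct_limit_def by metis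
  have W: "W \<in> obj C" "W' \<in> obj C" using h Mor_obj by blast+
  have q: "q a \<in> Mor C (Z a) W" "q' a \<in> Mor C (Z a) W'" if "a \<in> I" for a
    using that co co' unfolding cocone_def by blast+
  have "k \<cdot> h = ident C W"
  proof (rule direct_limit_arrow_eqI[OF RI p lim comp_Mor[OF h(1) k(1)] ident_Mor[OF W(1)]])
    show "(k \<cdot> h) \<cdot> q a = ident C W \<cdot> q a" if "a \<in> I" for a
      unfolding comp_assoc[OF q(1)[OF that] h(1) k(1), symmetric] h(2)[OF that] k(2)[OF that]
      by (rule ident_left[OF q(1)[OF that], symmetric])
  qed
  moreover have "h \<cdot> k = ident C W'"
  proof (rule direct_limit_arrow_eqI[OF RI p lim' comp_Mor[OF k(1) h(1)] ident_Mor[OF W(2)]])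
    show "(h \<cdot> k) \<cdot> q' a = ident C W' \<cdot> q' a" if "a \<in> I" for a
      unfolding comp_assoc[OF q(2)[OF that] k(1) h(1), symmetric] k(2)[OF that] h(2)[OF that]
      by (rule ident_left[OF q(2)[OF that], symmetric])
  qed
  ultimately have "h \<in> isomorphisms C W W'"
    by (rule isomorphismsI[OF h(1) k(1)])
  then show ?thesis unfolding isomorphic_def by blast
qed

lemma cocone_reindex:
  assumes co: "cocone C I R Z p Y f" and d: "\<And>a. a \<in> J \<Longrightarrow> d a \<in> I"
    and R': "\<And>a b. (a, b) \<in> R' \<Longrightarrow> a \<in> J \<and> b \<in> J \<and> (d a, d b) \<in> R"
    and Z': "\<And>a. a \<in> J \<Longrightarrow> Z' a = Z (d a)"
    and p': "\<And>a b. (a, b) \<in> R' \<Longrightarrow> p' a b = p (d a) (d b)"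
  shows "cocone C J R' Z' p' Y (f \<circ> d)"
  using co d R' Z' p' unfolding cocone_def by auto

text \<open>
  Besides a change of index type, this covers the congruence rule for limits (take the
  identity for \<open>d\<close>): a limit depends only on the objects at indices in the index set and on
  the arrows along related pairs.
\<close>

lemma direct_limit_reindex:
  assumes lim: "direct_limit C I R Z p W q" and d: "bij_betw d J I"
    and RI: "R \<subseteq> I \<times> I" and RJ: "R' \<subseteq> J \<times> J"
    and R': "\<And>a b. a \<in> J \<Longrightarrow> b \<in> J \<Longrightarrow> (a, b) \<in> R' \<longleftrightarrow> (d a, d b) \<in> R"
    and Z': "\<And>a. a \<in> J \<Longrightarrow> Z' a = Z (d a)"
    and p': "\<And>a b. (a, b) \<in> R' \<Longrightarrow> p' a b = p (d a) (d b)"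
  shows "direct_limit C J R' Z' p' W (q \<circ> d)"
proof -
  define e where "e = inv_into J d"
  have dI: "d a \<in> I" if "a \<in> J" for a using d that by (auto simp: bij_betw_def)
  have eJ: "e a \<in> J" and de: "d (e a) = a" if "a \<in> I" for a
    using d that unfolding e_def bij_betw_def by (auto intro: inv_into_into f_inv_into_f)
  have ed: "e (d a) = a" if "a \<in> J" for a
    using d that unfolding e_def bij_betw_def by auto
  have co: "cocone C J R' Z' p' W (q \<circ> d)"
    using lim dI RJ R' Z' p' by (intro cocone_reindex[of I R Z p]) (auto simp: direct_limit_def)
  show ?thesis
    unfolding direct_limit_def
  proof (intro conjI co allI impI)
    fix Y f assume f: "cocone C J R' Z' p' Y f"
    have "cocone C I R Z p Y (f \<circ> e)"
    proof (rule cocone_reindex[OF f])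
      show ab: "a \<in> I \<and> b \<in> I \<and> (e a, e b) \<in> R'" if "(a, b) \<in> R" for a b
        using that RI R'[OF eJ eJ, of a b] de by auto
      show "p a b = p' (e a) (e b)" if "(a, b) \<in> R" for a b
        using p'[of "e a" "e b"] ab[OF that] de by simp
    qed (use eJ de Z' in auto)
    then have ex: "\<exists>!h. h \<in> Mor C W Y \<and> (\<forall>a \<in> I. h \<cdot> q a = (f \<circ> e) a)"
      using lim unfolding direct_limit_def by blast
    have "(\<forall>a \<in> I. h \<cdot> q a = (f \<circ> e) a) \<longleftrightarrow> (\<forall>a \<in> J. h \<cdot> (q \<circ> d) a = f a)" for h
      using dI eJ de ed by (metis comp_apply)
    then show "\<exists>!h. h \<in> Mor C W Y \<and> (\<forall>a \<in> J. h \<cdot> (q \<circ> d) a = f a)"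
      using ex by simp
  qed
qed

text \<open>
  Cocones of the two diagrams correspond by composition with the isomorphisms \<open>i\<close> and \<open>j\<close>.
\<close>

lemma direct_limit_isomorphic_objects:
  assumes lim: "direct_limit C I R Z p W q"
    and RI: "R \<subseteq> I \<times> I" and p: "\<And>a b. (a, b) \<in> R \<Longrightarrow> p a b \<in> Mor C (Z a) (Z b)"
    and i: "\<And>a. a \<in> I \<Longrightarrow> i a \<in> Mor C (Z a) (Z' a)" and j: "\<And>a. a \<in> I \<Longrightarrow> j a \<in> Mor C (Z' a) (Z a)"
    and ji: "\<And>a. a \<in> I \<Longrightarrow> j a \<cdot> i a = ident C (Z a)"
    and ij: "\<And>a. a \<in> I \<Longrightarrow> i a \<cdot> j a = ident C (Z' a)"
  shows "direct_limit C I R Z' (\<lambda>a b. i b \<cdot> (p a b \<cdot> j a)) W (\<lambda>a. q a \<cdot> j a)"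
proof -
  have co: "cocone C I R Z p W q" using lim by (simp add: direct_limit_def)
  have q: "q a \<in> Mor C (Z a) W" if "a \<in> I" for a
    using co that by (simp add: cocone_def)
  have transfer: "cocone C I R Z' (\<lambda>a b. i b \<cdot> (p a b \<cdot> j a)) Y (\<lambda>a. f a \<cdot> j a)"
    if f: "cocone C I R Z p Y f" for Y f
    unfolding cocone_def
  proof (intro conjI ballI allI impI)
    show "Y \<in> obj C" using f by (simp add: cocone_def)
    show "f a \<cdot> j a \<in> Mor C (Z' a) Y" if "a \<in> I" for a
      using that f j comp_Mor unfolding cocone_def by blast
    show "(f b \<cdot> j b) \<cdot> (i b \<cdot> (p a b \<cdot> j a)) = f a \<cdot> j a" if ab: "(a, b) \<in> R" for a b
    proof -
      have ab': "a \<in> I" "b \<in> I" using ab RI by auto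
      have fb: "f b \<in> Mor C (Z b) Y" and fp: "f b \<cdot> p a b = f a"
        using f ab ab' by (auto simp: cocone_def)
      have pj: "p a b \<cdot> j a \<in> Mor C (Z' a) (Z b)"
        using comp_Mor[OF j[OF ab'(1)] p[OF ab]] .
      show ?thesis
        using comp_assoc[OF comp_Mor[OF pj i[OF ab'(2)]] j[OF ab'(2)] fb]
          cancel_left_inverse[OF i[OF ab'(2)] j[OF ab'(2)] ji[OF ab'(2)] pj]
          comp_assoc[OF j[OF ab'(1)] p[OF ab] fb] fp by simp
    qed
  qed
  show ?thesis
    unfolding direct_limit_def
  proof (intro conjI transfer co allI impI)
    fix Y f assume f: "cocone C I R Z' (\<lambda>a b. i b \<cdot> (p a b \<cdot> j a)) Y f"
    have fM: "f a \<in> Mor C (Z' a) Y" if "a \<in> I" for a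
      using f that by (simp add: cocone_def)
    have "cocone C I R Z p Y (\<lambda>a. f a \<cdot> i a)"
      unfolding cocone_def
    proof (intro conjI ballI allI impI)
      show "Y \<in> obj C" using f by (simp add: cocone_def)
      show "f a \<cdot> i a \<in> Mor C (Z a) Y" if "a \<in> I" for a
        using that fM i comp_Mor by blast
      show "(f b \<cdot> i b) \<cdot> p a b = f a \<cdot> i a" if ab: "(a, b) \<in> R" for a b
      proof -
        have ab': "a \<in> I" "b \<in> I" using ab RI by auto
        note ia = i[OF ab'(1)] and ib = i[OF ab'(2)] and ja = j[OF ab'(1)]
        have pj: "p a b \<cdot> j a \<in> Mor C (Z' a) (Z b)"
          using comp_Mor[OF ja p[OF ab]] .
        have "f a \<cdot> i a = (f b \<cdot> (i b \<cdot> (p a b \<cdot> j a))) \<cdot> i a"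
          using f ab by (simp add: cocone_def)
        also have "\<dots> = f b \<cdot> (i b \<cdot> ((p a b \<cdot> j a) \<cdot> i a))"
          using comp_assoc[OF ia comp_Mor[OF pj ib] fM[OF ab'(2)]] comp_assoc[OF ia pj ib] by simp
        also have "\<dots> = (f b \<cdot> i b) \<cdot> p a b"
          using cancel_right_inverse[OF ia ja ji[OF ab'(1)] p[OF ab]]
            comp_assoc[OF p[OF ab] ib fM[OF ab'(2)]] by simp
        finally show ?thesis by simp
      qed
    qed
    then have ex: "\<exists>!h. h \<in> Mor C W Y \<and> (\<forall>a \<in> I. h \<cdot> q a = f a \<cdot> i a)"
      using lim unfolding direct_limit_def by blast
    have eq: "h \<cdot> q a = f a \<cdot> i a \<longleftrightarrow> h \<cdot> (q a \<cdot> j a) = f a"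
      if a: "a \<in> I" and h: "h \<in> Mor C W Y" for h a
    proof
      assume "h \<cdot> q a = f a \<cdot> i a"
      then show "h \<cdot> (q a \<cdot> j a) = f a"
        using comp_assoc[OF j[OF a] q[OF a] h]
          cancel_right_inverse[OF j[OF a] i[OF a] ij[OF a] fM[OF a]] by simp
    next
      assume "h \<cdot> (q a \<cdot> j a) = f a"
      then have "f a \<cdot> i a = h \<cdot> ((q a \<cdot> j a) \<cdot> i a)"
        using comp_assoc[OF i[OF a] comp_Mor[OF j[OF a] q[OF a]] h] by simp
      then show "h \<cdot> q a = f a \<cdot> i a"
        using cancel_right_inverse[OF i[OF a] j[OF a] ji[OF a] q[OF a]] by simp
    qed
    have "(h \<in> Mor C W Y \<and> (\<forall>a \<in> I. h \<cdot> q a = f a \<cdot> i a)) \<longleftrightarrow>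
        (h \<in> Mor C W Y \<and> (\<forall>a \<in> I. h \<cdot> (q a \<cdot> j a) = f a))" for h
      using eq by blast
    then show "\<exists>!h. h \<in> Mor C W Y \<and> (\<forall>a \<in> I. h \<cdot> (q a \<cdot> j a) = f a)"
      using ex by simp
  qed
qed

end

section \<open>Directed diagrams over arbitrary index types\<close>

text \<open>
  This is \<open>direct_system\<close> without the bound on the size of the index set, so the index type is
  free: finite subsets of an index set will serve as indices.
\<close>

definition directed_diagram ::
  "('o, 'm, 'z) category_scheme \<Rightarrow> 'i set \<Rightarrow> 'i rel \<Rightarrow> ('i \<Rightarrow> 'o) \<Rightarrow> ('i \<Rightarrow> 'i \<Rightarrow> 'm) \<Rightarrow> bool"
where
  "directed_diagram C I R Z p \<longleftrightarrow> I \<noteq> {} \<and> preorder_on I R \<and>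
     (\<forall>a \<in> I. \<forall>b \<in> I. \<exists>c \<in> I. (a, c) \<in> R \<and> (b, c) \<in> R) \<and>
     (\<forall>a \<in> I. Z a \<in> obj C) \<and>
     (\<forall>a b. (a, b) \<in> R \<longrightarrow> p a b \<in> Mor C (Z a) (Z b)) \<and>
     (\<forall>a \<in> I. p a a = ident C (Z a)) \<and>
     (\<forall>a b c. (a, b) \<in> R \<longrightarrow> (b, c) \<in> R \<longrightarrow> p b c \<cdot>\<^bsub>C\<^esub> p a b = p a c)"

lemma direct_system_iff:
  fixes I :: "'u set"
  shows "direct_system C I R Z p \<longleftrightarrow> small TYPE('u) I \<and> directed_diagram C I R Z p"
  unfolding direct_system_def directed_set_def directed_diagram_def by blast

lemma directed_diagram_order: "directed_diagram C I R Z p \<Longrightarrow> R \<subseteq> I \<times> I"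
  unfolding directed_diagram_def preorder_on_def by blast

lemma directed_diagram_Mor:
  "directed_diagram C I R Z p \<Longrightarrow> (a, b) \<in> R \<Longrightarrow> p a b \<in> Mor C (Z a) (Z b)"
  unfolding directed_diagram_def by blast

lemma directed_diagram_reindex:
  assumes dia: "directed_diagram C I R Z p" and d: "bij_betw d J I"
  shows "directed_diagram C J {(a, b) \<in> J \<times> J. (d a, d b) \<in> R} (Z \<circ> d) (\<lambda>a b. p (d a) (d b))"
proof -
  have dI: "d a \<in> I" if "a \<in> J" for a using d that by (auto simp: bij_betw_def)
  have surj: "\<exists>a \<in> J. d a = x" if "x \<in> I" for x using d that unfolding bij_betw_def by blast
  have ne: "J \<noteq> {}" using dia surj unfolding directed_diagram_def by blast
  have pre: "preorder_on J {(a, b) \<in> J \<times> J. (d a, d b) \<in> R}"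
    using dia dI unfolding directed_diagram_def preorder_on_def refl_on_def trans_def by blast
  have dir: "\<exists>c \<in> J. (d a, d c) \<in> R \<and> (d b, d c) \<in> R" if "a \<in> J" "b \<in> J" for a b
  proof -
    have dab: "d a \<in> I" "d b \<in> I" using that dI by blast+
    obtain z where "z \<in> I" "(d a, z) \<in> R" "(d b, z) \<in> R"
      using dia dab unfolding directed_diagram_def by blast
    then show ?thesis using surj by blast
  qed
  show ?thesis
    using ne pre dir dia dI unfolding directed_diagram_def by auto
qed

lemma finite_upper_bound:
  assumes "preorder_on I R" and "I \<noteq> {}"
    and "\<forall>a \<in> I. \<forall>b \<in> I. \<exists>c \<in> I. (a, c) \<in> R \<and> (b, c) \<in> R"
    and "finite A" "A \<subseteq> I"
  shows "\<exists>c \<in> I. \<forall>a \<in> A. (a, c) \<in> R"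
  using assms(4,5)
proof (induction A rule: finite_induct)
  case empty
  then show ?case using assms(2) by blast
next
  case (insert x A)
  then obtain c where c: "c \<in> I" "\<forall>a \<in> A. (a, c) \<in> R" by auto
  obtain d where "d \<in> I" "(x, d) \<in> R" "(c, d) \<in> R"
    using assms(3) c(1) insert.prems by blast
  then show ?case
    using c assms(1) unfolding preorder_on_def trans_def by blast
qed

text \<open>
  The choice is by recursion along strict inclusion of finite sets: \<open>b F\<close> has to bound the
  elements of \<open>F\<close> and the finitely many values \<open>b G\<close> for proper subsets \<open>G\<close> of \<open>F\<close>.
\<close>

lemma monotone_upper_bounds:
  assumes pre: "preorder_on I R" and ne: "I \<noteq> {}"
    and dir: "\<forall>a \<in> I. \<forall>b \<in> I. \<exists>c \<in> I. (a, c) \<in> R \<and> (b, c) \<in> R"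
  obtains b where "\<And>F. F \<in> Fpow I \<Longrightarrow> b F \<in> I" "\<And>F x. F \<in> Fpow I \<Longrightarrow> x \<in> F \<Longrightarrow> (x, b F) \<in> R"
    "\<And>F G. F \<in> Fpow I \<Longrightarrow> G \<subseteq> F \<Longrightarrow> (b G, b F) \<in> R"
proof -
  define P where "P b F y \<longleftrightarrow> (F \<in> Fpow I \<longrightarrow>
    y \<in> I \<and> (\<forall>x \<in> F. (x, y) \<in> R) \<and> (\<forall>G. G \<subset> F \<longrightarrow> (b G, y) \<in> R))" for b F y
  have "\<exists>b. \<forall>F. P b F (b F)"
  proof (rule dependent_wf_choice[OF wf_finite_psubset])
    show "P f F y = P g F y" if "\<And>G. (G, F) \<in> finite_psubset \<Longrightarrow> f G = g G" for f g F y
      using that unfolding P_def Fpow_def finite_psubset_def by auto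
    show "\<exists>y. P f F y" if IH: "\<And>G. (G, F) \<in> finite_psubset \<Longrightarrow> P f G (f G)" for F f
    proof (cases "F \<in> Fpow I")
      case True
      then have fin: "finite (F \<union> f ` {G. G \<subset> F})"
        by (auto simp: Fpow_def intro: finite_subset[of _ "Pow F"])
      have "f G \<in> I" if "G \<subset> F" for G
      proof -
        have "P f G (f G)"
          using True that by (intro IH) (auto simp: finite_psubset_def Fpow_def)
        moreover have "G \<in> Fpow I"
          using True that unfolding Fpow_def by (auto intro: finite_subset)
        ultimately show ?thesis unfolding P_def by blast
      qed
      then have "F \<union> f ` {G. G \<subset> F} \<subseteq> I" using True by (auto simp: Fpow_def)
      then obtain c where c: "c \<in> I" "\<forall>a \<in> F \<union> f ` {G. G \<subset> F}. (a, c) \<in> R"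
        using finite_upper_bound[OF pre ne dir fin] by blast
      then have "P f F c" unfolding P_def by blast
      then show ?thesis by blast
    qed (simp add: P_def)
  qed
  then obtain b where b: "\<And>F. P b F (b F)" by blast
  show thesis
  proof (rule that[of b])
    fix F assume F: "F \<in> Fpow I"
    show "b F \<in> I" using b[of F] F unfolding P_def by blast
    show "(x, b F) \<in> R" if "x \<in> F" for x using b[of F] F that unfolding P_def by blast
    show "(b G, b F) \<in> R" if "G \<subseteq> F" for G
    proof (cases "G = F")
      case True
      then show ?thesis
        using pre \<open>b F \<in> I\<close> unfolding preorder_on_def refl_on_def by blast
    next
      case False
      then show ?thesis using b[of F] F that unfolding P_def by blast
    qed
  qed
qed

definition closed_under_direct_limits ::
  "('o, 'm, 'u, 'z) sized_category_scheme \<Rightarrow> 'o set \<Rightarrow> bool"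
where
  "closed_under_direct_limits C G \<longleftrightarrow> (\<forall>(I :: 'u set) R Z p W q.
     direct_system C I R Z p \<longrightarrow> Z ` I \<subseteq> G \<longrightarrow> direct_limit C I R Z p W q \<longrightarrow> W \<in> G)"

section \<open>Cardinal categories over an inaccessible universe\<close>

locale universe_cardinal_category = cardinal_category C
  for C :: "('o, 'm, 'u, 'z) sized_category_scheme" (structure) +
  assumes universe: "inaccessible_universe TYPE('u)"
begin

lemma mono_cancel:
  assumes "u \<in> Mor C X Y" "v \<in> Mor C A X" "w \<in> Mor C A X" "u \<cdot> v = u \<cdot> w"
  shows "v = w"
proof -
  have "monomorphism C u" "dom C u = X" using assms(1) Arr_mono by (auto simp: Mor_def)
  then show ?thesis using assms(2-4) unfolding monomorphism_def by blast
qed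

text \<open>
  If \<open>s \<cdot> w\<close> is an identity then \<open>s \<cdot> (w \<cdot> s) = s\<close>, and the monomorphism \<open>s\<close> can be cancelled.
\<close>

lemma right_invertible_isomorphism:
  assumes s: "s \<in> Mor C X Y" and w: "w \<in> Mor C Y X" and sw: "s \<cdot> w = ident C Y"
  shows "s \<in> isomorphisms C X Y"
proof (rule isomorphismsI[OF s w _ sw])
  have X: "X \<in> obj C" using Mor_obj s by blast
  have "s \<cdot> (w \<cdot> s) = s \<cdot> ident C X"
    using comp_assoc[OF s w s] sw ident_left[OF s] ident_right[OF s] by simp
  then show "w \<cdot> s = ident C X"
    using mono_cancel[OF s comp_Mor[OF s w] ident_Mor[OF X]] by blast
qed

lemma isomorphism_left_factor:
  assumes q: "q \<in> Mor C X Y" and s: "s \<in> Mor C Y Z" and iso: "s \<cdot> q \<in> isomorphisms C X Z"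
  shows "s \<in> isomorphisms C Y Z"
proof -
  obtain w where w: "w \<in> Mor C Z X" "(s \<cdot> q) \<cdot> w = ident C Z"
    using iso by (rule isomorphismsE)
  then have "s \<cdot> (q \<cdot> w) = ident C Z" using comp_assoc[OF w(1) q s] by simp
  then show ?thesis by (rule right_invertible_isomorphism[OF s comp_Mor[OF w(1) q]])
qed

text \<open>
  Direct systems are indexed by subsets of the universe, so the diagram is copied there along
  an injection and its limit is carried back.
\<close>

lemma direct_limit_exists:
  fixes I :: "'i set"
  assumes small: "small TYPE('u) I" and dia: "directed_diagram C I R Z p"
  shows "\<exists>W q. direct_limit C I R Z p W q"
proof -
  obtain e :: "'i \<Rightarrow> 'u" where e: "inj_on e I" using small_code[OF small] by blast
  define J where "J = e ` I"
  define d where "d = inv_into I e"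
  define R' where "R' = {(a, b) \<in> J \<times> J. (d a, d b) \<in> R}"
  have d: "bij_betw d J I"
    using e unfolding d_def J_def by (rule bij_betw_inv_into[OF inj_on_imp_bij_betw])
  have de: "d (e a) = a" if "a \<in> I" for a using e that unfolding d_def by simp
  have "direct_system C J R' (Z \<circ> d) (\<lambda>a b. p (d a) (d b))"
    unfolding direct_system_iff R'_def using directed_diagram_reindex[OF dia d]
      small_image[OF small] J_def by blast
  then obtain W q where lim: "direct_limit C J R' (Z \<circ> d) (\<lambda>a b. p (d a) (d b)) W q"
    using Sys by blast
  have RI: "R \<subseteq> I \<times> I" by (rule directed_diagram_order[OF dia])
  have "direct_limit C I R Z p W (q \<circ> e)"
  proof (rule direct_limit_reindex[OF lim])
    show "bij_betw e I J" using e unfolding J_def by (rule inj_on_imp_bij_betw)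
    show "R' \<subseteq> J \<times> J" unfolding R'_def by blast
    show "R \<subseteq> I \<times> I" by (rule RI)
    show "(a, b) \<in> R \<longleftrightarrow> (e a, e b) \<in> R'" if "a \<in> I" "b \<in> I" for a b
      using that de by (simp add: R'_def J_def)
    show "Z a = (Z \<circ> d) (e a)" if "a \<in> I" for a using that de by simp
    show "p a b = p (d (e a)) (d (e b))" if "(a, b) \<in> R" for a b
      using that RI de by (auto simp: subset_iff)
  qed
  then show ?thesis by blast
qed

section \<open>Maximal objects\<close>

text \<open>
  Transfinite recursion along the whole universe: after an arbitrary start, \<open>Z a\<close> is reached
  from the limit of the earlier objects by one arrow that is not invertible.  The composite of
  that arrow with any arrow into the limit is still not invertible
  (\<open>isomorphism_left_factor\<close>).
\<close>

lemma endless_chain: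
  assumes ne: "G \<noteq> {}"
    and closed: "closed_under_direct_limits C G"
    and sub: "G \<subseteq> obj C"
    and grow: "\<forall>X \<in> G. \<exists>Y \<in> G. \<exists>s \<in> Mor C X Y. s \<notin> isomorphisms C X Y"
  shows "\<exists>(Z :: 'u \<Rightarrow> 'o) t. (\<forall>a. Z a \<in> G) \<and> (\<forall>a. \<forall>b \<in> underS |UNIV :: 'u set| a.
    t b a \<in> Mor C (Z b) (Z a) - isomorphisms C (Z b) (Z a) \<and>
    (\<forall>c \<in> underS |UNIV :: 'u set| b. t b a \<cdot> t c b = t c a))"
proof -
  let ?r = "|UNIV :: 'u set|"
  have wo: "well_order_on UNIV ?r" by (rule card_of_well_order_on)
  have wf: "wf (?r - Id)" using wo by (simp add: well_order_on_def)
  have rtrans: "(x, z) \<in> ?r" if "(x, y) \<in> ?r" "(y, z) \<in> ?r" for x y z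
    using wo that
    unfolding well_order_on_def linear_order_on_def partial_order_on_def preorder_on_def trans_def
    by blast
  have rrefl: "(x, x) \<in> ?r" for x
    using wo unfolding well_order_on_def linear_order_on_def partial_order_on_def preorder_on_def
      refl_on_def by blast
  have rtotal: "(x, y) \<in> ?r \<or> (y, x) \<in> ?r" for x y
    using wo rrefl unfolding well_order_on_def linear_order_on_def total_on_def
    by (cases "x = y") auto
  have rantisym: "x = y" if "(x, y) \<in> ?r" "(y, x) \<in> ?r" for x y
    using wo that unfolding well_order_on_def linear_order_on_def partial_order_on_def antisym_def
    by blast
  have small_underS: "small TYPE('u) (underS ?r a)" for a
    using card_of_underS[OF card_of_Card_order, of a "UNIV :: 'u set"]
    by (simp add: small_def Field_card_of)
  \<comment> \<open>A value of the recursion at \<open>a\<close> is the object \<open>Z a\<close> with its incoming arrows; the arrow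
    function is meaningful only below \<open>a\<close>.\<close>
  define P where "P f a z \<longleftrightarrow> fst z \<in> G \<and> (\<forall>b \<in> underS ?r a.
      snd z b \<in> Mor C (fst (f b)) (fst z) - isomorphisms C (fst (f b)) (fst z) \<and>
      (\<forall>c \<in> underS ?r b. snd z b \<cdot> snd (f b) c = snd z c))"
    for f :: "'u \<Rightarrow> 'o \<times> ('u \<Rightarrow> 'm)" and a and z :: "'o \<times> ('u \<Rightarrow> 'm)"
  have "\<exists>f. \<forall>a. P f a (f a)"
  proof (rule dependent_wf_choice[OF wf])
    show "P f a z = P g a z" if "\<And>b. (b, a) \<in> ?r - Id \<Longrightarrow> f b = g b" for f g a z
    proof -
      have "f b = g b" if "b \<in> underS ?r a" for b
        using that \<open>\<And>b. (b, a) \<in> ?r - Id \<Longrightarrow> f b = g b\<close> by (auto simp: underS_def)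
      then show ?thesis unfolding P_def by auto
    qed
  next
    fix a and f :: "'u \<Rightarrow> 'o \<times> ('u \<Rightarrow> 'm)"
    assume "\<And>b. (b, a) \<in> ?r - Id \<Longrightarrow> P f b (f b)"
    then have IH: "P f b (f b)" if "b \<in> underS ?r a" for b
      using that by (auto simp: underS_def)
    define I where "I = underS ?r a"
    define R where "R = {(b, c). b \<in> I \<and> c \<in> I \<and> (b, c) \<in> ?r}"
    define Z where "Z b = fst (f b)" for b
    define p where "p b c = (if b = c then ident C (Z b) else snd (f c) b)" for b c
    show "\<exists>z. P f a z"
    proof (cases "I = {}")
      case True
      then show ?thesis using ne unfolding P_def I_def by auto
    next
      case False
      have ZG: "Z b \<in> G" if "b \<in> I" for b
        using IH[of b] that by (simp add: P_def Z_def I_def)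
      have arrow: "snd (f c) b \<in> Mor C (Z b) (Z c)"
        and tr: "d \<in> underS ?r b \<Longrightarrow> snd (f c) b \<cdot> snd (f b) d = snd (f c) d"
        if "c \<in> I" "b \<in> underS ?r c" for b c d
        using IH[of c] that by (auto simp: P_def Z_def I_def)
      have pM: "p b c \<in> Mor C (Z b) (Z c)" if "(b, c) \<in> R" for b c
        using that arrow[of c b] ident_Mor ZG sub
        by (auto simp: p_def R_def underS_def)
      have pcomp: "p c d \<cdot> p b c = p b d" if bc: "(b, c) \<in> R" and cd: "(c, d) \<in> R" for b c d
      proof -
        consider "b = c" | "c = d" | "b \<noteq> c" "c \<noteq> d" by blast
        then show ?thesis
        proof cases
          case 1
          then show ?thesis using ident_right[OF pM[OF cd]] by (simp add: p_def)
        next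
          case 2
          then show ?thesis using ident_left[OF pM[OF bc]] by (simp add: p_def)
        next
          case 3
          then have "c \<in> underS ?r d" "b \<in> underS ?r c" "d \<in> I" "b \<noteq> d"
            using bc cd rantisym by (auto simp: R_def underS_def)
          then show ?thesis using tr[of d c b] 3 by (simp add: p_def)
        qed
      qed
      have sys: "direct_system C I R Z p"
        unfolding direct_system_iff directed_diagram_def
      proof (intro conjI ballI allI impI)
        show "small TYPE('u) I" using small_underS by (simp add: I_def)
        show "preorder_on I R"
          using rrefl rtrans unfolding preorder_on_def refl_on_def trans_def R_def by blast
        show "\<exists>d \<in> I. (b, d) \<in> R \<and> (c, d) \<in> R" if "b \<in> I" "c \<in> I" for b c
          using that rtotal[of b c] rrefl by (auto simp: R_def)
      qed (use False ZG sub pM pcomp in \<open>auto simp: p_def\<close>)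
      then obtain W q where lim: "direct_limit C I R Z p W q" using Sys by blast
      then have "W \<in> G" using closed sys ZG
        unfolding closed_under_direct_limits_def by (metis image_subsetI)
      then obtain Y s where Y: "Y \<in> G" and s: "s \<in> Mor C W Y" "s \<notin> isomorphisms C W Y"
        using grow by blast
      have q: "q b \<in> Mor C (Z b) W" if "b \<in> I" for b
        using lim that by (simp add: direct_limit_def cocone_def)
      have "P f a (Y, \<lambda>b. s \<cdot> q b)"
        unfolding P_def fst_conv snd_conv
      proof (intro conjI ballI Y)
        fix b assume "b \<in> underS ?r a"
        then have b: "b \<in> I" by (simp add: I_def)
        show "s \<cdot> q b \<in> Mor C (fst (f b)) Y - isomorphisms C (fst (f b)) Y"
          using comp_Mor[OF q[OF b] s(1)] isomorphism_left_factor[OF q[OF b] s(1)] s(2)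
          by (auto simp: Z_def)
        fix c assume c: "c \<in> underS ?r b"
        then have cI: "c \<in> I" and cb: "c \<noteq> b"
          using b rtrans rantisym unfolding I_def underS_def by blast+
        then have R: "(c, b) \<in> R" using b c by (simp add: R_def underS_def)
        have "snd (f b) c = p c b" using cb by (simp add: p_def)
        moreover have "q b \<cdot> p c b = q c"
          using lim R by (simp add: direct_limit_def cocone_def)
        ultimately show "(s \<cdot> q b) \<cdot> snd (f b) c = s \<cdot> q c"
          using comp_assoc[OF pM[OF R] q[OF b] s(1)] by simp
      qed
      then show ?thesis by blast
    qed
  qed
  then obtain f where f: "\<And>a. P f a (f a)" by blast
  show ?thesis
    by (rule exI[of _ "\<lambda>a. fst (f a)"], rule exI[of _ "\<lambda>b a. snd (f a) b"])
      (use f in \<open>simp add: P_def\<close>)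
qed

text \<open>
  Otherwise there is an endless chain.  Fix \<open>a\<close> and transport its arrows \<open>t b a\<close> to a small set
  of representatives of the isomorphism types.  If two of them, for \<open>b\<close> below \<open>c\<close>, became
  equal, then \<open>t b a = t c a \<cdot> t b c\<close> could be cancelled to show that \<open>t b c\<close> is invertible.
  Hence the predecessors of \<open>a\<close> embed in the small set \<open>K\<close> of arrows between representatives,
  although \<open>a\<close> can be chosen with more than \<open>|K|\<close> predecessors.
\<close>

lemma maximal_object_exists:
  assumes ne: "G \<noteq> {}" and sub: "G \<subseteq> obj C" and proper: "proper C G"
    and closed: "closed_under_direct_limits C G"
  shows "\<exists>X \<in> G. \<forall>Y \<in> G. Mor C X Y \<subseteq> isomorphisms C X Y"
proof (rule ccontr)
  let ?r = "|UNIV :: 'u set|"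
  assume "\<not> (\<exists>X \<in> G. \<forall>Y \<in> G. Mor C X Y \<subseteq> isomorphisms C X Y)"
  then have grow: "\<forall>X \<in> G. \<exists>Y \<in> G. \<exists>s \<in> Mor C X Y. s \<notin> isomorphisms C X Y"
    by blast
  obtain Z t where chain: "(\<forall>a. Z a \<in> G) \<and> (\<forall>a. \<forall>b \<in> underS ?r a.
    t b a \<in> Mor C (Z b) (Z a) - isomorphisms C (Z b) (Z a) \<and>
    (\<forall>c \<in> underS ?r b. t b a \<cdot> t c b = t c a))"
    using endless_chain[OF ne closed sub grow] by (elim exE)
  have ZG: "Z a \<in> G" for a using chain by blast
  have t: "t b a \<in> Mor C (Z b) (Z a) - isomorphisms C (Z b) (Z a)" if "b \<in> underS ?r a" for a b
    using chain that by blast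
  have tt: "t b a \<cdot> t c b = t c a" if "b \<in> underS ?r a" "c \<in> underS ?r b" for a b c
    using chain that by blast
  obtain W0 where W0: "W0 \<subseteq> obj C" "small TYPE('u) W0"
    and rep: "\<And>X. X \<in> G \<Longrightarrow> \<exists>Y \<in> W0. isomorphic C X Y"
    using proper unfolding proper_def by blast
  define K where "K = (\<Union>X \<in> W0. \<Union>Y \<in> W0. Mor C X Y)"
  have "small TYPE('u) K"
    unfolding K_def using W0 Arr_set by (intro small_UNION[OF universe]) auto
  then obtain a where a: "|K| <o |underS ?r a|"
    using initial_segments_unbounded[OF universe] by blast
  have "\<forall>b. \<exists>V i j. V \<in> W0 \<and> i \<in> isomorphisms C (Z b) V \<and> j \<in> isomorphisms C V (Z b)
      \<and> j \<cdot> i = ident C (Z b)"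
  proof
    fix b
    obtain V i where "V \<in> W0" "i \<in> isomorphisms C (Z b) V"
      using rep[OF ZG[of b]] by (auto simp: isomorphic_def)
    then show "\<exists>V i j. V \<in> W0 \<and> i \<in> isomorphisms C (Z b) V \<and> j \<in> isomorphisms C V (Z b)
      \<and> j \<cdot> i = ident C (Z b)" by (metis isomorphismsE)
  qed
  then obtain V i j where V: "\<And>b. V b \<in> W0" and i: "\<And>b. i b \<in> isomorphisms C (Z b) (V b)"
    and j: "\<And>b. j b \<in> isomorphisms C (V b) (Z b)" and ji: "\<And>b. j b \<cdot> i b = ident C (Z b)"
    by metis
  have iM: "i b \<in> Mor C (Z b) (V b)" and jM: "j b \<in> Mor C (V b) (Z b)" for b
    using i j by (auto simp: isomorphisms_def)
  define k where "k b = i a \<cdot> (t b a \<cdot> j b)" for b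
  have tM: "t b c \<in> Mor C (Z b) (Z c)" if "b \<in> underS ?r c" for b c
    using t[OF that] by blast
  have tj: "t b a \<cdot> j b \<in> Mor C (V b) (Z a)" if "b \<in> underS ?r a" for b
    using comp_Mor[OF jM tM[OF that]] .
  have kM: "k b \<in> Mor C (V b) (V a)" if "b \<in> underS ?r a" for b
    unfolding k_def using comp_Mor[OF tj[OF that] iM] .
  have neq: "k b \<noteq> k c" if b: "b \<in> underS ?r c" and c: "c \<in> underS ?r a"
    and ba: "b \<in> underS ?r a" for b c
  proof
    assume eq: "k b = k c"
    then have Vbc: "V b = V c" using kM[OF c] kM[OF ba] by (auto simp: Mor_def)
    have "t b a \<cdot> j b = t c a \<cdot> j c"
      using mono_cancel[OF iM tj[OF ba]] tj[OF c] eq Vbc unfolding k_def by auto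
    then have "t c a \<cdot> (t b c \<cdot> j b) = t c a \<cdot> j c"
      using comp_assoc[OF jM tM[OF b] tM[OF c]] tt[OF c b] by simp
    then have "t b c \<cdot> j b = j c"
      using mono_cancel[OF tM[OF c] comp_Mor[OF jM tM[OF b]]] jM[of c] Vbc by simp
    then have "t b c = j c \<cdot> i b"
      using cancel_right_inverse[OF iM jM ji tM[OF b]] by simp
    then have "t b c \<in> isomorphisms C (Z b) (Z c)"
      using comp_isomorphisms[of "i b" "Z b" "V b" "j c" "Z c"] i[of b] j[of c] Vbc by simp
    then show False using t[OF b] by blast
  qed
  have "inj_on k (underS ?r a)"
  proof (rule inj_onI, rule ccontr)
    fix b c assume bc: "b \<in> underS ?r a" "c \<in> underS ?r a" "k b = k c" "b \<noteq> c"
    then have "b \<in> underS ?r c \<or> c \<in> underS ?r b"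
      using card_of_well_order_on[of "UNIV :: 'u set"]
      by (auto simp: well_order_on_def linear_order_on_def total_on_def underS_def)
    then show False using neq bc by metis
  qed
  moreover have "k ` underS ?r a \<subseteq> K"
    using kM V unfolding K_def by blast
  ultimately have "|underS ?r a| \<le>o |K|" using card_of_ordLeq by blast
  then show False using a not_ordLess_ordLeq by blast
qed

end

section \<open>The class generated by a finitary structure\<close>

context universe_cardinal_category
begin

lemma generated_subset_obj: "generated C F \<subseteq> obj C"
  by (auto simp: generated_def)

lemma generated_downward: "Y \<in> generated C F \<Longrightarrow> X \<in> obj C \<Longrightarrow> prec C X Y \<Longrightarrow> X \<in> generated C F"
  unfolding generated_def using prec_trans by blast

lemma generated_closed_under_direct_limits: "closed_under_direct_limits C (generated C F)"
  unfolding closed_under_direct_limits_def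
proof (intro allI impI)
  fix I :: "'u set" and R Z p W q
  assume sys: "direct_system C I R Z p" and Z: "Z ` I \<subseteq> generated C F"
    and lim: "direct_limit C I R Z p W q"
  have "A \<in> F" if A: "fin_size C A" "prec C A W" for A
  proof -
    obtain a where "a \<in> I" "prec C A (Z a)" using Emb[OF A(1) sys lim A(2)] by blast
    then show ?thesis using Z A(1) unfolding generated_def by blast
  qed
  moreover have "W \<in> obj C" using lim by (simp add: direct_limit_def cocone_def)
  ultimately show "W \<in> generated C F" by (simp add: generated_def)
qed

lemma finitary_structure_subset_generated:
  assumes "finitary_structure C F" shows "F \<subseteq> generated C F"
  using assms unfolding finitary_structure_def generated_def fin_size_def by blast

text \<open>
  The graph \<open>P\<close> of the arrows alone remembers the whole diagram: indices are the \<open>a\<close> for which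
  \<open>(a, a)\<close> occurs in it, and the object at \<open>a\<close> is the domain of the arrow at \<open>(a, a)\<close>.  So \<open>P\<close>
  is a code for the isomorphism type of the limit, and codes over small sets form a small set.
\<close>

definition presents :: "'u set \<Rightarrow> (('u \<times> 'u) \<times> 'm) set \<Rightarrow> 'o \<Rightarrow> bool" where
  "presents M P Y \<longleftrightarrow> (\<exists>I R Z p W q. I \<subseteq> M \<and> preorder_on I R \<and>
     (\<forall>a b. (a, b) \<in> R \<longrightarrow> p a b \<in> Mor C (Z a) (Z b)) \<and>
     P = (\<lambda>(a, b). ((a, b), p a b)) ` R \<and> direct_limit C I R Z p W q \<and> isomorphic C Y W)"

lemma presents_unique:
  assumes "presents M P Y" and "presents M P Y'"
  shows "isomorphic C Y Y'"
proof -
  obtain I R Z p W q where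
    I: "preorder_on I R" "\<And>a b. (a, b) \<in> R \<Longrightarrow> p a b \<in> Mor C (Z a) (Z b)"
      "P = (\<lambda>(a, b). ((a, b), p a b)) ` R"
    and lim: "direct_limit C I R Z p W q" and YW: "isomorphic C Y W"
    using assms(1) unfolding presents_def by blast
  obtain I' R' Z' p' W' q' where
    I': "preorder_on I' R'" "\<And>a b. (a, b) \<in> R' \<Longrightarrow> p' a b \<in> Mor C (Z' a) (Z' b)"
      "P = (\<lambda>(a, b). ((a, b), p' a b)) ` R'"
    and lim': "direct_limit C I' R' Z' p' W' q'" and YW': "isomorphic C Y' W'"
    using assms(2) unfolding presents_def by blast
  have R: "R = R'"
  proof -
    have "R = Domain P" unfolding I(3) by force
    also have "\<dots> = R'" unfolding I'(3) by force
    finally show ?thesis .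
  qed
  have p: "p a b = p' a b" if "(a, b) \<in> R" for a b
  proof -
    have "((a, b), p a b) \<in> P" unfolding I(3) using that by force
    then show ?thesis unfolding I'(3) by auto
  qed
  have "I = I'"
    using I(1) I'(1) R unfolding preorder_on_def refl_on_def by blast
  have RI: "R \<subseteq> I \<times> I" using I(1) by (simp add: preorder_on_def)
  have Z: "Z a = Z' a" if "a \<in> I" for a
  proof -
    have aa: "(a, a) \<in> R" using I(1) that by (simp add: preorder_on_def refl_on_def)
    then show ?thesis using I(2)[OF aa] I'(2)[of a a] p R by (simp add: Mor_def)
  qed
  have "direct_limit C I R Z p W' (q' \<circ> id)"
    by (rule direct_limit_reindex[OF lim'])
      (use RI R p Z \<open>I = I'\<close> in \<open>auto simp: bij_betw_def\<close>)
  from direct_limit_unique[OF RI I(2) lim this] have "isomorphic C W W'" .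
  then show ?thesis using isomorphic_trans isomorphic_sym YW YW' by metis
qed

text \<open>
  Write \<open>Y\<close> as a limit of finite objects, replace these by their representatives in \<open>W0\<close>, and
  copy the index set into \<open>M\<close>.
\<close>

lemma presents_exists:
  assumes Y: "Y \<in> obj C" and inf: "\<not> finite_cardinal (osize C Y)" and size: "osize C Y \<le>o |M|"
    and rep: "\<And>A. A \<in> Fin C Y \<Longrightarrow> \<exists>V \<in> W0. isomorphic C A V"
  shows "\<exists>P \<subseteq> (M \<times> M) \<times> (\<Union>V \<in> W0. \<Union>V' \<in> W0. Mor C V V'). presents M P Y"
proof -
  obtain I :: "'u set" and R Z p W q where sys: "direct_system C I R Z p"
    and cI: "|I| \<le>o osize C Y" and fin: "\<forall>a \<in> I. fin_size C (Z a)"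
    and lim: "direct_limit C I R Z p W q" and iso: "isomorphic C Y W"
    using Lim[OF Y inf] by blast
  have dia: "directed_diagram C I R Z p" using sys direct_system_iff by blast
  note RI = directed_diagram_order[OF dia] and pM = directed_diagram_Mor[OF dia]
  have "|I| \<le>o |M|" using cI size ordLeq_transitive by blast
  then obtain e where e: "inj_on e I" "e ` I \<subseteq> M" unfolding card_of_ordLeq[symmetric] by blast
  define J where "J = e ` I"
  define d where "d = inv_into I e"
  have d: "bij_betw d J I"
    using e(1) unfolding d_def J_def by (rule bij_betw_inv_into[OF inj_on_imp_bij_betw])
  have dI: "d a \<in> I" if "a \<in> J" for a using d that by (auto simp: bij_betw_def)
  have "\<forall>a \<in> I. \<exists>V i j. V \<in> W0 \<and> i \<in> Mor C (Z a) V \<and> j \<in> Mor C V (Z a)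
      \<and> j \<cdot> i = ident C (Z a) \<and> i \<cdot> j = ident C V"
  proof
    fix a assume a: "a \<in> I"
    then have "q a \<in> Mor C (Z a) W" using lim by (simp add: direct_limit_def cocone_def)
    then have "prec C (Z a) W" by (auto simp: prec_def)
    then have "prec C (Z a) Y"
      using prec_trans isomorphic_imp_prec isomorphic_sym[OF iso] by blast
    then have "Z a \<in> Fin C Y" using fin a by (simp add: Fin_def)
    then obtain V i where "V \<in> W0" "i \<in> isomorphisms C (Z a) V"
      using rep[of "Z a"] unfolding isomorphic_def by blast
    then show "\<exists>V i j. V \<in> W0 \<and> i \<in> Mor C (Z a) V \<and> j \<in> Mor C V (Z a)
      \<and> j \<cdot> i = ident C (Z a) \<and> i \<cdot> j = ident C V" by (metis isomorphismsE)
  qed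
  then obtain V i j where V: "\<And>a. a \<in> I \<Longrightarrow> V a \<in> W0"
    and i: "\<And>a. a \<in> I \<Longrightarrow> i a \<in> Mor C (Z a) (V a)" and j: "\<And>a. a \<in> I \<Longrightarrow> j a \<in> Mor C (V a) (Z a)"
    and ji: "\<And>a. a \<in> I \<Longrightarrow> j a \<cdot> i a = ident C (Z a)"
    and ij: "\<And>a. a \<in> I \<Longrightarrow> i a \<cdot> j a = ident C (V a)"
    by metis
  define p1 where "p1 a b = i b \<cdot> (p a b \<cdot> j a)" for a b
  have p1: "p1 a b \<in> Mor C (V a) (V b)" if "(a, b) \<in> R" for a b
    unfolding p1_def using that RI by (intro comp_Mor[OF comp_Mor[OF j pM] i]) auto
  have lim1: "direct_limit C I R V p1 W (\<lambda>a. q a \<cdot> j a)"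
    unfolding p1_def by (rule direct_limit_isomorphic_objects[OF lim RI pM i j ji ij])
  define R' where "R' = {(a, b) \<in> J \<times> J. (d a, d b) \<in> R}"
  define p' where "p' a b = p1 (d a) (d b)" for a b
  define P where "P = (\<lambda>(a, b). ((a, b), p' a b)) ` R'"
  have p': "p' a b \<in> Mor C (V (d a)) (V (d b))" if "(a, b) \<in> R'" for a b
    using that p1 by (simp add: p'_def R'_def)
  have "direct_limit C J R' (V \<circ> d) p' W ((\<lambda>a. q a \<cdot> j a) \<circ> d)"
    by (rule direct_limit_reindex[OF lim1 d RI]) (auto simp: R'_def p'_def)
  moreover have "preorder_on J R'"
    using directed_diagram_reindex[OF dia d] unfolding R'_def directed_diagram_def by blast
  ultimately have "presents M P Y"
    unfolding presents_def using e(2) p' iso P_def J_def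
    by (intro exI[of _ J] exI[of _ R'] exI[of _ "V \<circ> d"] exI[of _ p'] exI[of _ W]
        exI[of _ "(\<lambda>a. q a \<cdot> j a) \<circ> d"]) auto
  moreover have "P \<subseteq> (M \<times> M) \<times> (\<Union>V \<in> W0. \<Union>V' \<in> W0. Mor C V V')"
  proof -
    have "a \<in> M \<and> b \<in> M \<and> p' a b \<in> (\<Union>V \<in> W0. \<Union>V' \<in> W0. Mor C V V')"
      if ab: "(a, b) \<in> R'" for a b
    proof -
      have "a \<in> J" "b \<in> J" using ab by (auto simp: R'_def)
      then show ?thesis using p'[OF ab] V[OF dI] e(2) unfolding J_def by blast
    qed
    then show ?thesis unfolding P_def by auto
  qed
  ultimately show ?thesis by blast
qed

text \<open>
  Objects of finite size in the generated class lie in \<open>F\<close>.  The others have sizes bounded by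
  one cardinal \<open>m\<close>, hence have codes over the one small set \<open>Field m\<close>.
\<close>

lemma generated_proper:
  assumes F: "proper C F" and SBP: "SBP C F"
  shows "proper C (generated C F)"
proof -
  obtain W0 where W0: "W0 \<subseteq> obj C" "small TYPE('u) W0"
    and rep: "\<And>X. X \<in> F \<Longrightarrow> \<exists>Y \<in> W0. isomorphic C X Y"
    using F unfolding proper_def by blast
  obtain m :: "'u rel" where m: "cardinal_number m" "\<And>X. X \<in> generated C F \<Longrightarrow> osize C X \<le>o m"
    using SBP unfolding SBP_def by blast
  define M where "M = Field m"
  have mM: "|M| =o m" using m(1) card_of_Field_ordIso unfolding M_def cardinal_number_def by blast
  then have M: "small TYPE('u) M"
    using m(1) ordIso_ordLess_trans unfolding cardinal_number_def small_def by blast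
  define T where "T = Pow ((M \<times> M) \<times> (\<Union>V \<in> W0. \<Union>V' \<in> W0. Mor C V V'))"
  have T: "small TYPE('u) T"
    unfolding T_def using W0 Arr_set M
    by (intro small_Pow[OF universe] small_Times[OF universe] small_UNION[OF universe]) auto
  define rp where "rp P = (SOME Y. Y \<in> obj C \<and> presents M P Y)" for P
  define W1 where "W1 = rp ` {P \<in> T. \<exists>Y \<in> obj C. presents M P Y}"
  have rp: "rp P \<in> obj C \<and> presents M P (rp P)" if "\<exists>Y \<in> obj C. presents M P Y" for P
    unfolding rp_def by (rule someI_ex) (use that in blast)
  have "small TYPE('u) W1"
    unfolding W1_def by (intro small_image small_subset[OF T]) auto
  then have "small TYPE('u) (W0 \<union> W1)"
    by (rule small_Un[OF universe W0(2)])
  moreover have "W0 \<union> W1 \<subseteq> obj C"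
    using W0(1) rp unfolding W1_def by blast
  moreover have "\<exists>Y \<in> W0 \<union> W1. isomorphic C X Y" if X: "X \<in> generated C F" for X
  proof (cases "finite_cardinal (osize C X)")
    case True
    have "X \<in> obj C" using X by (simp add: generated_def)
    then have "X \<in> F" using X True prec_refl by (simp add: generated_def fin_size_def)
    then show ?thesis using rep by blast
  next
    case False
    have XO: "X \<in> obj C" using X by (simp add: generated_def)
    have "\<exists>V \<in> W0. isomorphic C A V" if "A \<in> Fin C X" for A
      using that X rep unfolding generated_def Fin_def by blast
    moreover have "osize C X \<le>o |M|"
      using m(2)[OF X] ordIso_symmetric[OF mM] by (rule ordLeq_ordIso_trans)
    ultimately obtain P where P: "P \<in> T" "presents M P X"
      using presents_exists[OF XO False] unfolding T_def by (metis PowI)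
    then have "rp P \<in> W1" and "presents M P (rp P)"
      using XO rp[of P] unfolding W1_def by blast+
    then show ?thesis using presents_unique[OF P(2)] by blast
  qed
  ultimately show ?thesis unfolding proper_def by blast
qed

text \<open>
  A maximal object \<open>X\<close> of the generated class is absolutely homogeneous: amalgamating two arrows
  \<open>u\<close> and \<open>v\<close> into \<open>X\<close> gives \<open>p \<cdot> u = q \<cdot> v\<close> with \<open>p\<close> and \<open>q\<close> invertible by maximality.
  Every member of \<open>E\<close> embeds in \<open>X\<close>, because a common extension of the two objects is isomorphic
  to \<open>X\<close>.
\<close>

lemma skeletoid_star_AP_imp_skeleton:
  assumes E: "skeletoid C E" and AP: "star_AP C E" and ne: "E \<noteq> {}"
  shows "skeleton C E"
proof -
  let ?G = "generated C E"
  have fs: "finitary_structure C E" using E by (simp add: skeletoid_def)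
  have EG: "E \<subseteq> ?G" by (rule finitary_structure_subset_generated[OF fs])
  have "proper C ?G"
    using E by (intro generated_proper) (auto simp: skeletoid_def)
  then have "\<exists>X \<in> ?G. \<forall>Y \<in> ?G. Mor C X Y \<subseteq> isomorphisms C X Y"
    using maximal_object_exists[OF _ generated_subset_obj _ generated_closed_under_direct_limits]
      EG ne by blast
  then obtain X where X: "X \<in> ?G" and max: "\<And>Y u. Y \<in> ?G \<Longrightarrow> u \<in> Mor C X Y \<Longrightarrow> u \<in> isomorphisms C X Y"
    by blast
  have XO: "X \<in> obj C" using X by (simp add: generated_def)
  have "\<exists>\<phi> \<in> Aut C X. v = \<phi> \<cdot> u" if A: "A \<in> obj C"
    and u: "u \<in> Mor C A X" and v: "v \<in> Mor C A X" for A u v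
  proof -
    have "A \<in> ?G" using generated_downward[OF X A] u by (auto simp: prec_def)
    then obtain W p q where W: "W \<in> ?G" and p: "p \<in> Mor C X W" and q: "q \<in> Mor C X W"
      and pq: "p \<cdot> u = q \<cdot> v"
      using AP X u v unfolding star_AP_def AP_def by blast
    obtain q' where q': "q' \<in> Mor C W X" "q' \<in> isomorphisms C W X" "q' \<cdot> q = ident C X"
      using max[OF W q] by (rule isomorphismsE)
    have "(q' \<cdot> p) \<cdot> u = v"
      using comp_assoc[OF u p q'(1)] pq cancel_left_inverse[OF q q'(1) q'(3) v] by simp
    moreover have "q' \<cdot> p \<in> Aut C X"
      unfolding Aut_def by (rule comp_isomorphisms[OF max[OF W p] q'(2)])
    ultimately show ?thesis by blast
  qed
  then have "AB_HO C X" using XO by (simp add: AB_HO_def)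
  moreover have "Fin C X = E"
  proof
    show "Fin C X \<subseteq> E" using X unfolding Fin_def generated_def by blast
    show "E \<subseteq> Fin C X"
    proof
      fix A assume A: "A \<in> E"
      then obtain Z where Z: "Z \<in> ?G" "prec C A Z" "prec C X Z"
        using AP X EG unfolding star_AP_def AP_def by blast
      obtain s where "s \<in> Mor C X Z" using Z(3) by (auto simp: prec_def)
      then have "isomorphic C X Z" using max[OF Z(1)] by (auto simp: isomorphic_def)
      then have "prec C A X"
        using Z(2) prec_trans isomorphic_imp_prec isomorphic_sym by blast
      then show "A \<in> Fin C X" using A fs by (simp add: Fin_def finitary_structure_def)
    qed
  qed
  ultimately show ?thesis using XO unfolding skeleton_def by blast
qed

end

section \<open>Universality of absolutely homogeneous objects\<close>

definition finite_inclusion :: "'i set \<Rightarrow> 'i set rel" where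
  "finite_inclusion S = {(F, G). F \<subseteq> G \<and> G \<in> Fpow S}"

lemma finite_inclusion_subset: "finite_inclusion S \<subseteq> Fpow S \<times> Fpow S"
  unfolding finite_inclusion_def Fpow_def by (auto intro: finite_subset)

lemma finite_inclusion_diagram:
  assumes "\<And>F. F \<in> Fpow S \<Longrightarrow> Z F \<in> obj C"
    and "\<And>F G. G \<in> Fpow S \<Longrightarrow> F \<subseteq> G \<Longrightarrow> p F G \<in> Mor C (Z F) (Z G)"
    and "\<And>F. F \<in> Fpow S \<Longrightarrow> p F F = ident C (Z F)"
    and "\<And>F G H. H \<in> Fpow S \<Longrightarrow> F \<subseteq> G \<Longrightarrow> G \<subseteq> H \<Longrightarrow> p G H \<cdot>\<^bsub>C\<^esub> p F G = p F H"
  shows "directed_diagram C (Fpow S) (finite_inclusion S) Z p"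
  unfolding directed_diagram_def
proof (intro conjI ballI allI impI)
  show "Fpow S \<noteq> {}" using empty_in_Fpow by blast
  show "preorder_on (Fpow S) (finite_inclusion S)"
    using finite_inclusion_subset[of S]
    unfolding preorder_on_def refl_on_def trans_def by (auto simp: finite_inclusion_def)
  show "\<exists>H \<in> Fpow S. (F, H) \<in> finite_inclusion S \<and> (G, H) \<in> finite_inclusion S"
    if "F \<in> Fpow S" "G \<in> Fpow S" for F G
    using that by (intro bexI[of _ "F \<union> G"]) (auto simp: finite_inclusion_def Fpow_def)
qed (use assms in \<open>auto simp: finite_inclusion_def\<close>)

lemma finite_inclusion_diagram_restrict:
  assumes dia: "directed_diagram C (Fpow S) (finite_inclusion S) Z p" and TS: "T \<subseteq> S"
  shows "directed_diagram C (Fpow T) (finite_inclusion T) Z p"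
proof (rule finite_inclusion_diagram)
  have sub: "F \<in> Fpow S" if "F \<in> Fpow T" for F using that TS by (auto simp: Fpow_def)
  have R: "(F, G) \<in> finite_inclusion S" if "G \<in> Fpow T" "F \<subseteq> G" for F G
    using that sub by (auto simp: finite_inclusion_def)
  show "Z F \<in> obj C" and "p F F = ident C (Z F)" if "F \<in> Fpow T" for F
    using dia sub[OF that] unfolding directed_diagram_def by blast+
  show "p F G \<in> Mor C (Z F) (Z G)" if "G \<in> Fpow T" "F \<subseteq> G" for F G
    using dia R[OF that] unfolding directed_diagram_def by blast
  show "p G H \<cdot>\<^bsub>C\<^esub> p F G = p F H" if H: "H \<in> Fpow T" and "F \<subseteq> G" "G \<subseteq> H" for F G H
  proof -
    have "G \<in> Fpow T" using that by (auto simp: Fpow_def intro: finite_subset)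
    then show ?thesis using dia R that unfolding directed_diagram_def by blast
  qed
qed

lemma cocone_finite_inclusion_restrict:
  assumes "cocone C (Fpow S) (finite_inclusion S) Z p X g" and "T \<subseteq> S"
  shows "cocone C (Fpow T) (finite_inclusion T) Z p X g"
proof -
  have "F \<in> Fpow S" if "F \<in> Fpow T" for F using Fpow_mono[OF assms(2)] that by blast
  moreover from this have "(F, G) \<in> finite_inclusion S" if "(F, G) \<in> finite_inclusion T" for F G
    using that by (simp add: finite_inclusion_def)
  ultimately show ?thesis using assms(1) by (simp add: cocone_def)
qed

text \<open>
  Every finite subset of the union of a chain is contained in one of its members, which is why
  diagrams indexed by finite subsets are continuous along chains.
\<close>

lemma glue_cocones:
  assumes ne: "Q \<noteq> {}"
    and chain: "\<And>s t. s \<in> Q \<Longrightarrow> t \<in> Q \<Longrightarrow> T s \<subseteq> T t \<or> T t \<subseteq> T s"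
    and co: "\<And>t. t \<in> Q \<Longrightarrow> cocone C (Fpow (T t)) (finite_inclusion (T t)) Z p X (g t)"
    and agree: "\<And>s t F. s \<in> Q \<Longrightarrow> t \<in> Q \<Longrightarrow> F \<in> Fpow (T s) \<Longrightarrow> F \<in> Fpow (T t) \<Longrightarrow> g s F = g t F"
  obtains h where "cocone C (Fpow (\<Union>t \<in> Q. T t)) (finite_inclusion (\<Union>t \<in> Q. T t)) Z p X h"
    and "\<And>t F. t \<in> Q \<Longrightarrow> F \<in> Fpow (T t) \<Longrightarrow> h F = g t F"
proof -
  let ?U = "\<Union>t \<in> Q. T t"
  define h where "h F = g (SOME t. t \<in> Q \<and> F \<in> Fpow (T t)) F" for F
  have h: "h F = g t F" if t: "t \<in> Q" "F \<in> Fpow (T t)" for t F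
  proof -
    let ?s = "SOME t. t \<in> Q \<and> F \<in> Fpow (T t)"
    have "?s \<in> Q \<and> F \<in> Fpow (T ?s)" 
      using t by (intro someI[of "\<lambda>t. t \<in> Q \<and> F \<in> Fpow (T t)" t] conjI)
    then show ?thesis unfolding h_def by (intro agree t) simp_all
  qed
  have ex: "\<exists>t \<in> Q. F \<in> Fpow (T t)" if F: "F \<in> Fpow ?U" for F
  proof -
    have fin: "finite F" "F \<subseteq> \<Union>(T ` Q)" using F by (auto simp: Fpow_def)
    have "subset.chain UNIV (T ` Q)"
      using chain unfolding subset_chain_def by blast
    then obtain B where "B \<in> T ` Q" "F \<subseteq> B"
      using finite_subset_Union_chain[OF fin] ne by (metis image_is_empty)
    then show ?thesis using fin(1) by (auto simp: Fpow_def)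
  qed
  have "cocone C (Fpow ?U) (finite_inclusion ?U) Z p X h"
    unfolding cocone_def
  proof (intro conjI ballI allI impI)
    show "X \<in> obj C" using ne co by (auto simp: cocone_def)
    show "h F \<in> Mor C (Z F) X" if F: "F \<in> Fpow ?U" for F
    proof -
      obtain t where t: "t \<in> Q" "F \<in> Fpow (T t)" using ex[OF F] by blast
      then show ?thesis using co[OF t(1)] h[OF t] by (simp add: cocone_def)
    qed
    show "h G \<cdot>\<^bsub>C\<^esub> p F G = h F" if FG: "(F, G) \<in> finite_inclusion ?U" for F G
    proof -
      have "G \<in> Fpow ?U" using FG by (simp add: finite_inclusion_def)
      then obtain t where t: "t \<in> Q" "G \<in> Fpow (T t)" using ex by blast
      have R: "(F, G) \<in> finite_inclusion (T t)" using FG t(2) by (simp add: finite_inclusion_def)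
      then have "F \<in> Fpow (T t)" using finite_inclusion_subset by blast
      then show ?thesis
        using co[OF t(1)] h[OF t] h[OF t(1)] R by (simp add: cocone_def)
    qed
  qed
  then show thesis using h by (rule that)
qed

context universe_cardinal_category
begin

text \<open>
  The two cocones are two arrows from one limit into \<open>X\<close>, to which homogeneity applies whatever
  the size of that limit.
\<close>

lemma AB_HO_cocones_conjugate:
  assumes X: "AB_HO C X" and small: "small TYPE('u) I" and dia: "directed_diagram C I R Z p"
    and g: "cocone C I R Z p X g" and h: "cocone C I R Z p X h"
  obtains \<phi> where "\<phi> \<in> Aut C X" "\<And>a. a \<in> I \<Longrightarrow> g a = \<phi> \<cdot> h a"
proof -
  obtain W q where lim: "direct_limit C I R Z p W q"
    using direct_limit_exists[OF small dia] by blast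
  obtain g' where g': "g' \<in> Mor C W X" "\<And>a. a \<in> I \<Longrightarrow> g' \<cdot> q a = g a"
    using lim g unfolding direct_limit_def by metis
  obtain h' where h': "h' \<in> Mor C W X" "\<And>a. a \<in> I \<Longrightarrow> h' \<cdot> q a = h a"
    using lim h unfolding direct_limit_def by metis
  have "W \<in> obj C" using Mor_obj g'(1) by blast
  then obtain \<phi> where \<phi>: "\<phi> \<in> Aut C X" "g' = \<phi> \<cdot> h'"
    using X g'(1) h'(1) unfolding AB_HO_def by blast
  then have \<phi>M: "\<phi> \<in> Mor C X X" by (simp add: Aut_def isomorphisms_def)
  show thesis
  proof (rule that[OF \<phi>(1)])
    fix a assume a: "a \<in> I"
    have q: "q a \<in> Mor C (Z a) W" using lim a by (simp add: direct_limit_def cocone_def)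
    show "g a = \<phi> \<cdot> h a"
      using comp_assoc[OF q h'(1) \<phi>M] g'(2)[OF a] h'(2)[OF a] \<phi>(2) by simp
  qed
qed

text \<open>
  If any cocone on \<open>S\<close> exists at all, an automorphism of \<open>X\<close> turns it into one that prolongs the
  cocone given on \<open>T\<close>.
\<close>

lemma AB_HO_extend_cocone:
  assumes X: "AB_HO C X" and small: "small TYPE('u) S"
    and dia: "directed_diagram C (Fpow S) (finite_inclusion S) Z p" and TS: "T \<subseteq> S"
    and g: "cocone C (Fpow T) (finite_inclusion T) Z p X g"
    and h: "cocone C (Fpow S) (finite_inclusion S) Z p X h"
  obtains k where "cocone C (Fpow S) (finite_inclusion S) Z p X k"
    and "\<And>F. F \<in> Fpow T \<Longrightarrow> k F = g F"
proof -
  have "small TYPE('u) (Fpow T)"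
    using TS by (intro small_subset[OF small_Pow[OF universe small]]) (auto simp: Fpow_def)
  then obtain \<phi> where \<phi>: "\<phi> \<in> Aut C X" "\<And>F. F \<in> Fpow T \<Longrightarrow> g F = \<phi> \<cdot> h F"
    using AB_HO_cocones_conjugate[OF X _ finite_inclusion_diagram_restrict[OF dia TS] g
        cocone_finite_inclusion_restrict[OF h TS]] by blast
  then have "\<phi> \<in> Mor C X X" by (simp add: Aut_def isomorphisms_def)
  then have "cocone C (Fpow S) (finite_inclusion S) Z p X (\<lambda>F. \<phi> \<cdot> h F)"
    using cocone_comp[OF finite_inclusion_subset directed_diagram_Mor[OF dia] h] by blast
  then show thesis using \<phi>(2) that by simp
qed

text \<open>
  Induction on the cardinality of \<open>S\<close>.  A finite \<open>S\<close> is the greatest index, so one arrow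
  determines the cocone.  An infinite \<open>S\<close> is the union of the initial segments of its cardinal
  order.  These are smaller than \<open>S\<close>, so each carries a cocone by the induction hypothesis, and
  the extension property lets these cocones be chosen coherently by transfinite recursion;
  finite subsets being the indices, coherent cocones on a chain of sets determine one on its
  union.
\<close>

lemma AB_HO_cocone_exists:
  assumes X: "AB_HO C X" and small: "small TYPE('u) I"
    and dia: "directed_diagram C (Fpow I) (finite_inclusion I) Z p"
    and emb: "\<And>F. F \<in> Fpow I \<Longrightarrow> prec C (Z F) X"
    and SI: "S \<subseteq> I"
  shows "\<exists>g. cocone C (Fpow S) (finite_inclusion S) Z p X g"
  using SI
proof (induction S rule: wf_induct_rule[OF wf_inv_image[OF wf_ordLess, of card_of]])
  case (1 S)
  have IH: "\<exists>g. cocone C (Fpow T) (finite_inclusion T) Z p X g" if "T \<subseteq> S" "|T| <o |S|" for T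
    using 1 that by (simp add: inv_image_def)
  have diaS: "directed_diagram C (Fpow T) (finite_inclusion T) Z p" if "T \<subseteq> S" for T
    by (rule finite_inclusion_diagram_restrict[OF dia]) (use that 1(2) in blast)
  have smallS: "small TYPE('u) T" if "T \<subseteq> S" for T
    by (rule small_subset[OF small]) (use that 1(2) in blast)
  show ?case
  proof (cases "finite S")
    case True
    then have S: "S \<in> Fpow S" "S \<in> Fpow I" using 1(2) by (auto simp: Fpow_def)
    obtain k where k: "k \<in> Mor C (Z S) X" using emb[OF S(2)] by (auto simp: prec_def)
    have pM: "p F G \<in> Mor C (Z F) (Z G)" if "G \<in> Fpow S" "F \<subseteq> G" for F G
      using directed_diagram_Mor[OF diaS[OF subset_refl]] that by (simp add: finite_inclusion_def)
    have "cocone C (Fpow S) (finite_inclusion S) Z p X (\<lambda>F. k \<cdot> p F S)"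
      unfolding cocone_def
    proof (intro conjI ballI allI impI)
      show "X \<in> obj C" using X by (simp add: AB_HO_def)
      show "k \<cdot> p F S \<in> Mor C (Z F) X" if "F \<in> Fpow S" for F
        using comp_Mor[OF pM[OF S(1)] k] that by (simp add: Fpow_def)
      show "(k \<cdot> p G S) \<cdot> p F G = k \<cdot> p F S" if FG: "(F, G) \<in> finite_inclusion S" for F G
      proof -
        have G: "G \<in> Fpow S" "F \<subseteq> G" "G \<subseteq> S"
          using FG by (auto simp: finite_inclusion_def Fpow_def)
        then have "(G, S) \<in> finite_inclusion S" using S(1) by (simp add: finite_inclusion_def)
        then have "p G S \<cdot> p F G = p F S"
          using diaS[OF subset_refl] FG unfolding directed_diagram_def by blast
        then show ?thesis using comp_assoc[OF pM[OF G(1,2)] pM[OF S(1) G(3)] k] by simp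
      qed
    qed
    then show ?thesis by blast
  next
    case False
    let ?r = "|S|"
    have wo: "well_order_on S ?r" by (rule card_of_well_order_on)
    have wf: "wf (?r - Id)" using wo by (simp add: well_order_on_def)
    have rS: "x \<in> S \<and> y \<in> S" if "(x, y) \<in> ?r" for x y
      using wo that well_order_on_domain by metis
    have rtrans: "(x, z) \<in> ?r" if "(x, y) \<in> ?r" "(y, z) \<in> ?r" for x y z
      using wo that
      unfolding well_order_on_def linear_order_on_def partial_order_on_def preorder_on_def trans_def
      by blast
    have rrefl: "(x, x) \<in> ?r" if "x \<in> S" for x
      using wo that
      unfolding well_order_on_def linear_order_on_def partial_order_on_def preorder_on_def
        refl_on_def by blast
    have rtotal: "(x, y) \<in> ?r \<or> (y, x) \<in> ?r" if "x \<in> S" "y \<in> S" for x y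
      using wo rrefl that unfolding well_order_on_def linear_order_on_def total_on_def
      by (cases "x = y") auto
    have under_mono: "under ?r x \<subseteq> under ?r y" if "(x, y) \<in> ?r" for x y
      using rtrans that unfolding under_def by blast
    have under_S: "under ?r x \<subseteq> S" for x using rS unfolding under_def by blast
    have under_less: "|under ?r x| <o |S|" if x: "x \<in> S" for x
    proof -
      obtain y where y: "y \<in> S" "x \<noteq> y" "(x, y) \<in> ?r"
        using infinite_Card_order_limit[OF card_of_Card_order[of S]] False x
        by (auto simp: Field_card_of)
      have "z \<noteq> y" if "(z, x) \<in> ?r" for z
        using y that wo unfolding well_order_on_def linear_order_on_def partial_order_on_def
          antisym_def by blast
      then have "under ?r x \<subseteq> underS ?r y"
        using rtrans y(3) unfolding under_def underS_def by blast
      then have "|under ?r x| \<le>o |underS ?r y|" by (rule card_of_mono1)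
      moreover have "|underS ?r y| <o |S|"
        using card_of_underS[OF card_of_Card_order[of S]] y(1) by (simp add: Field_card_of)
      ultimately show ?thesis using ordLeq_ordLess_trans by blast
    qed
    define P where "P f a g \<longleftrightarrow> (a \<in> S \<longrightarrow>
        cocone C (Fpow (under ?r a)) (finite_inclusion (under ?r a)) Z p X g \<and>
        (\<forall>b \<in> underS ?r a. \<forall>F \<in> Fpow (under ?r b). g F = f b F))" for f a g
    have glue: "\<exists>h. cocone C (Fpow (\<Union>b \<in> Q. under ?r b)) (finite_inclusion (\<Union>b \<in> Q. under ?r b)) Z p X h
        \<and> (\<forall>b \<in> Q. \<forall>F \<in> Fpow (under ?r b). h F = f b F)"
      if Q: "Q \<subseteq> S" "Q \<noteq> {}" and f: "\<And>b. b \<in> Q \<Longrightarrow> P f b (f b)" for Q f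
    proof (rule glue_cocones[of Q "under ?r" C Z p X f])
      show "Q \<noteq> {}" by (rule Q(2))
      show "under ?r s \<subseteq> under ?r t \<or> under ?r t \<subseteq> under ?r s" if "s \<in> Q" "t \<in> Q" for s t
        using rtotal under_mono that Q(1) by blast
      show "cocone C (Fpow (under ?r t)) (finite_inclusion (under ?r t)) Z p X (f t)" if "t \<in> Q" for t
        using f[OF that] that Q(1) unfolding P_def by blast
      show "f s F = f t F"
        if "s \<in> Q" "t \<in> Q" "F \<in> Fpow (under ?r s)" "F \<in> Fpow (under ?r t)" for s t F
      proof -
        have "s \<in> S" "t \<in> S" using that(1,2) Q(1) by blast+
        then consider "s = t" | "s \<in> underS ?r t" | "t \<in> underS ?r s"
          using rtotal unfolding underS_def by blast
        then show ?thesis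
        proof cases
          case 2
          then show ?thesis using f[OF that(2)] that(3) \<open>t \<in> S\<close> unfolding P_def by metis
        next
          case 3
          then show ?thesis using f[OF that(1)] that(4) \<open>s \<in> S\<close> unfolding P_def by metis
        qed simp
      qed
      show ?thesis
        if "cocone C (Fpow (\<Union>b \<in> Q. under ?r b)) (finite_inclusion (\<Union>b \<in> Q. under ?r b)) Z p X h"
          and "\<And>t F. t \<in> Q \<Longrightarrow> F \<in> Fpow (under ?r t) \<Longrightarrow> h F = f t F" for h
        using that by blast
    qed
    have "\<exists>f. \<forall>a. P f a (f a)"
    proof (rule dependent_wf_choice[OF wf])
      show "P f a g = P f' a g" if "\<And>b. (b, a) \<in> ?r - Id \<Longrightarrow> f b = f' b" for f f' a g
      proof -
        have "f b = f' b" if "b \<in> underS ?r a" for b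
          using that \<open>\<And>b. (b, a) \<in> ?r - Id \<Longrightarrow> f b = f' b\<close> by (auto simp: underS_def)
        then show ?thesis unfolding P_def by auto
      qed
    next
      fix a f
      assume "\<And>b. (b, a) \<in> ?r - Id \<Longrightarrow> P f b (f b)"
      then have f: "P f b (f b)" if "b \<in> underS ?r a" for b
        using that by (auto simp: underS_def)
      show "\<exists>g. P f a g"
      proof (cases "a \<in> S")
        case True
        obtain h where h: "cocone C (Fpow (under ?r a)) (finite_inclusion (under ?r a)) Z p X h"
          using IH[OF under_S under_less[OF True]] by blast
        show ?thesis
        proof (cases "underS ?r a = {}")
          case True
          then show ?thesis using h unfolding P_def by blast
        next
          case ne: False
          have sub: "underS ?r a \<subseteq> S" using rS unfolding underS_def by blast
          obtain g where g: "cocone C (Fpow (\<Union>b \<in> underS ?r a. under ?r b))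
              (finite_inclusion (\<Union>b \<in> underS ?r a. under ?r b)) Z p X g"
            and gf: "\<forall>b \<in> underS ?r a. \<forall>F \<in> Fpow (under ?r b). g F = f b F"
            using glue[OF sub ne f] by blast
          have "(\<Union>b \<in> underS ?r a. under ?r b) \<subseteq> under ?r a"
            using rtrans unfolding underS_def under_def by blast
          then obtain k where k: "cocone C (Fpow (under ?r a)) (finite_inclusion (under ?r a)) Z p X k"
            and kg: "\<And>F. F \<in> Fpow (\<Union>b \<in> underS ?r a. under ?r b) \<Longrightarrow> k F = g F"
            using AB_HO_extend_cocone[OF X smallS[OF under_S] diaS[OF under_S] _ g h] by blast
          have "k F = f b F" if b: "b \<in> underS ?r a" and F: "F \<in> Fpow (under ?r b)" for b F
          proof -
            have "F \<in> Fpow (\<Union>b \<in> underS ?r a. under ?r b)"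
              using F b unfolding Fpow_def by blast
            then show ?thesis using kg gf b F by simp
          qed
          then show ?thesis using k unfolding P_def by blast
        qed
      qed (simp add: P_def)
    qed
    then obtain f where f: "\<And>a. P f a (f a)" by blast
    have "S \<noteq> {}" using False by auto
    then obtain g where
      "cocone C (Fpow (\<Union>b \<in> S. under ?r b)) (finite_inclusion (\<Union>b \<in> S. under ?r b)) Z p X g"
      using glue[OF subset_refl _ f] by blast
    moreover have "(\<Union>b \<in> S. under ?r b) = S"
      using rrefl rS unfolding under_def by blast
    ultimately show ?thesis by auto
  qed
qed

text \<open>
  If the size of \<open>Y\<close> is infinite, then \<open>Y\<close> is a limit of finite objects over a directed set
  \<open>I\<close>.  Composition with monotone upper bounds \<open>b\<close> turns the diagram into one indexed by the
  finite subsets of \<open>I\<close>, where every subset \<open>S\<close> of \<open>I\<close> gives a directed subdiagram indexed by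
  the finite subsets of \<open>S\<close>, so induction on the cardinality of \<open>S\<close> applies.  A cocone of the
  new diagram yields one of the old diagram through the arrows from the object at \<open>a\<close> to the
  object at \<open>b {a}\<close>.
\<close>

lemma AB_HO_universal:
  assumes X: "AB_HO C X" and Y: "Y \<in> generated C (Fin C X)"
  shows "prec C Y X"
proof (cases "finite_cardinal (osize C Y)")
  case True
  have "Y \<in> obj C" using Y by (simp add: generated_def)
  then have "Y \<in> Fin C X" using Y True prec_refl by (simp add: generated_def fin_size_def)
  then show ?thesis by (simp add: Fin_def)
next
  case False
  have YO: "Y \<in> obj C" using Y by (simp add: generated_def)
  obtain I :: "'u set" and R Z p W q where sys: "direct_system C I R Z p"
    and fin: "\<forall>a \<in> I. fin_size C (Z a)"
    and lim: "direct_limit C I R Z p W q" and iso: "isomorphic C Y W"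
    using Lim[OF YO False] by blast
  have dia: "directed_diagram C I R Z p" and small: "small TYPE('u) I"
    using sys direct_system_iff by blast+
  note RI = directed_diagram_order[OF dia] and pM = directed_diagram_Mor[OF dia]
  have ne: "I \<noteq> {}" and pre: "preorder_on I R"
    and dir: "\<forall>a \<in> I. \<forall>b \<in> I. \<exists>c \<in> I. (a, c) \<in> R \<and> (b, c) \<in> R"
    and pcomp: "\<And>a b c. (a, b) \<in> R \<Longrightarrow> (b, c) \<in> R \<Longrightarrow> p b c \<cdot> p a b = p a c"
    using dia unfolding directed_diagram_def by blast+
  obtain b where bI: "\<And>F. F \<in> Fpow I \<Longrightarrow> b F \<in> I"
    and bub: "\<And>F x. F \<in> Fpow I \<Longrightarrow> x \<in> F \<Longrightarrow> (x, b F) \<in> R"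
    and bmono: "\<And>F G. F \<in> Fpow I \<Longrightarrow> G \<subseteq> F \<Longrightarrow> (b G, b F) \<in> R"
    using monotone_upper_bounds[OF pre ne dir] by blast
  have ZX: "prec C (Z a) X" if a: "a \<in> I" for a
  proof -
    have "q a \<in> Mor C (Z a) W" using lim a by (simp add: direct_limit_def cocone_def)
    then have "prec C (Z a) W" by (auto simp: prec_def)
    then have "prec C (Z a) Y"
      using prec_trans isomorphic_imp_prec isomorphic_sym[OF iso] by blast
    then show ?thesis using Y fin a unfolding generated_def Fin_def by blast
  qed
  have "directed_diagram C (Fpow I) (finite_inclusion I) (\<lambda>F. Z (b F)) (\<lambda>F G. p (b F) (b G))"
  proof (rule finite_inclusion_diagram)
    show "Z (b F) \<in> obj C" and "p (b F) (b F) = ident C (Z (b F))" if "F \<in> Fpow I" for F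
      using dia bI[OF that] unfolding directed_diagram_def by blast+
    show "p (b F) (b G) \<in> Mor C (Z (b F)) (Z (b G))" if "G \<in> Fpow I" "F \<subseteq> G" for F G
      by (rule pM[OF bmono[OF that]])
    show "p (b G) (b H) \<cdot> p (b F) (b G) = p (b F) (b H)"
      if H: "H \<in> Fpow I" and FG: "F \<subseteq> G" and GH: "G \<subseteq> H" for F G H
    proof -
      have "G \<in> Fpow I" using H GH by (auto simp: Fpow_def intro: finite_subset)
      then show ?thesis by (rule pcomp[OF bmono[OF _ FG] bmono[OF H GH]])
    qed
  qed
  from AB_HO_cocone_exists[OF X small this ZX[OF bI] subset_refl]
  obtain g where g: "cocone C (Fpow I) (finite_inclusion I) (\<lambda>F. Z (b F)) (\<lambda>F G. p (b F) (b G)) X g"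
    by blast
  have gM: "g F \<in> Mor C (Z (b F)) X" if "F \<in> Fpow I" for F
    using g that by (simp add: cocone_def)
  have gp: "g F \<cdot> p a (b F) = g {a} \<cdot> p a (b {a})" if a: "a \<in> F" and F: "F \<in> Fpow I" for a F
  proof -
    have a': "{a} \<in> Fpow I" using a F by (auto simp: Fpow_def)
    have "({a}, F) \<in> finite_inclusion I" using a F by (simp add: finite_inclusion_def)
    then have "g F \<cdot> p (b {a}) (b F) = g {a}" using g by (simp add: cocone_def)
    moreover have R: "(a, b {a}) \<in> R" "(b {a}, b F) \<in> R" using bub[OF a'] bmono[OF F] a by auto
    ultimately show ?thesis
      using comp_assoc[OF pM[OF R(1)] pM[OF R(2)] gM[OF F]] pcomp[OF R] by simp
  qed
  have "cocone C I R Z p X (\<lambda>a. g {a} \<cdot> p a (b {a}))"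
    unfolding cocone_def
  proof (intro conjI ballI allI impI)
    show "X \<in> obj C" using X by (simp add: AB_HO_def)
    show "g {a} \<cdot> p a (b {a}) \<in> Mor C (Z a) X" if "a \<in> I" for a
    proof -
      have "{a} \<in> Fpow I" using that by (simp add: Fpow_def)
      then show ?thesis using comp_Mor[OF pM[OF bub] gM] by blast
    qed
    show "(g {c} \<cdot> p c (b {c})) \<cdot> p a c = g {a} \<cdot> p a (b {a})" if ac: "(a, c) \<in> R" for a c
    proof -
      \<comment> \<open>Both sides are compared with the value at the common index \<open>{a, c}\<close>.\<close>
      have F: "{a, c} \<in> Fpow I" using ac RI by (auto simp: Fpow_def)
      have R: "(c, b {a, c}) \<in> R" using bub[OF F] by simp
      have "(g {c} \<cdot> p c (b {c})) \<cdot> p a c = (g {a, c} \<cdot> p c (b {a, c})) \<cdot> p a c"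
        using gp[of c "{a, c}"] F by simp
      also have "\<dots> = g {a, c} \<cdot> p a (b {a, c})"
        using comp_assoc[OF pM[OF ac] pM[OF R] gM[OF F]] pcomp[OF ac R] by simp
      also have "\<dots> = g {a} \<cdot> p a (b {a})" using gp[of a "{a, c}"] F by simp
      finally show ?thesis .
    qed
  qed
  then have "\<exists>h. h \<in> Mor C W X" using lim unfolding direct_limit_def by blast
  then have "prec C W X" by (auto simp: prec_def)
  then show ?thesis using iso isomorphic_imp_prec prec_trans by blast
qed

section \<open>Skeletons\<close>

lemma AB_HO_amalgamation:
  assumes X: "AB_HO C X" and Y: "prec C Y X" and Z: "prec C Z X"
    and u: "u \<in> Mor C A Y" and v: "v \<in> Mor C A Z"
  obtains p q where "p \<in> Mor C Y X" "q \<in> Mor C Z X" "p \<cdot> u = q \<cdot> v"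
proof -
  obtain a b where a: "a \<in> Mor C Y X" and b: "b \<in> Mor C Z X" using Y Z by (auto simp: prec_def)
  have "A \<in> obj C" using u Mor_obj by blast
  then obtain \<phi> where \<phi>: "\<phi> \<in> Aut C X" "b \<cdot> v = \<phi> \<cdot> (a \<cdot> u)"
    using X comp_Mor[OF u a] comp_Mor[OF v b] unfolding AB_HO_def by blast
  then have \<phi>M: "\<phi> \<in> Mor C X X" by (simp add: Aut_def isomorphisms_def)
  show thesis
    by (rule that[OF comp_Mor[OF a \<phi>M] b]) (simp add: \<phi>(2) comp_assoc[OF u a \<phi>M])
qed

lemma Fin_finitary_structure:
  assumes X: "X \<in> obj C"
  shows "finitary_structure C (Fin C X)"
  unfolding finitary_structure_def closed_under_iso_def
proof (intro conjI ballI allI impI)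
  show "fin_size C A" if "A \<in> Fin C X" for A using that by (simp add: Fin_def)
  show "B \<in> Fin C X" if A: "A \<in> Fin C X" and B: "B \<in> obj C" "isomorphic C A B" for A B
  proof -
    have AO: "A \<in> obj C" and "finite_cardinal (osize C A)" using A by (auto simp: Fin_def fin_size_def)
    moreover have "|Field (osize C A)| =o |Field (osize C B)|"
      using Card_iso[OF AO B] card_of_cong by blast
    ultimately have "finite_cardinal (osize C B)"
      using card_of_ordIso_finite unfolding finite_cardinal_def by blast
    moreover have "prec C B X"
      using A isomorphic_imp_prec[OF isomorphic_sym[OF B(2)]] prec_trans by (auto simp: Fin_def)
    ultimately show ?thesis using B(1) by (simp add: Fin_def fin_size_def)
  qed
  show "A \<in> Fin C X" if "fin_size C A" "prec C A B" "B \<in> Fin C X" for A B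
    using that prec_trans by (auto simp: Fin_def)
qed

text \<open>
  Homogeneity amalgamates inside \<open>X\<close>; directedness of the finite subobjects of \<open>X\<close> makes the
  amalgam finite, and the arrow \<open>\<gamma>\<close> from it into \<open>X\<close> can be cancelled.
\<close>

lemma Fin_AP:
  assumes X: "AB_HO C X"
  shows "AP C (Fin C X)"
  unfolding AP_def
proof (intro conjI ballI)
  have XO: "X \<in> obj C" using X by (simp add: AB_HO_def)
  fix A Y Z u v
  assume A: "A \<in> Fin C X" and Y: "Y \<in> Fin C X" and Z: "Z \<in> Fin C X"
    and u: "u \<in> Mor C A Y" and v: "v \<in> Mor C A Z"
  obtain p q where p: "p \<in> Mor C Y X" and q: "q \<in> Mor C Z X" and pq: "p \<cdot> u = q \<cdot> v"
    using AB_HO_amalgamation[OF X _ _ u v] Y Z by (auto simp: Fin_def)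
  obtain W \<alpha> \<beta> \<gamma> where W: "fin_size C W" and \<alpha>: "\<alpha> \<in> Mor C Y W" and \<beta>: "\<beta> \<in> Mor C Z W"
    and \<gamma>: "\<gamma> \<in> Mor C W X" and eq: "p = \<gamma> \<cdot> \<alpha>" "q = \<gamma> \<cdot> \<beta>"
    using Dir[OF _ _ XO p q] Y Z unfolding Fin_def by blast
  have "\<gamma> \<cdot> (\<alpha> \<cdot> u) = \<gamma> \<cdot> (\<beta> \<cdot> v)"
    using pq comp_assoc[OF u \<alpha> \<gamma>] comp_assoc[OF v \<beta> \<gamma>] eq by simp
  then have "\<alpha> \<cdot> u = \<beta> \<cdot> v"
    by (rule mono_cancel[OF \<gamma> comp_Mor[OF u \<alpha>] comp_Mor[OF v \<beta>]])
  moreover have "W \<in> Fin C X" using W \<gamma> by (auto simp: Fin_def prec_def)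
  ultimately show "\<exists>W \<in> Fin C X. \<exists>p \<in> Mor C Y W. \<exists>q \<in> Mor C Z W. p \<cdot> u = q \<cdot> v"
    using \<alpha> \<beta> by blast
next
  have XO: "X \<in> obj C" using X by (simp add: AB_HO_def)
  fix Y Z assume Y: "Y \<in> Fin C X" and Z: "Z \<in> Fin C X"
  obtain p q where p: "p \<in> Mor C Y X" and q: "q \<in> Mor C Z X"
    using Y Z by (auto simp: Fin_def prec_def)
  obtain W \<alpha> \<beta> \<gamma> where "fin_size C W" "\<alpha> \<in> Mor C Y W" "\<beta> \<in> Mor C Z W" "\<gamma> \<in> Mor C W X"
    using Dir[OF _ _ XO p q] Y Z unfolding Fin_def by blast
  then show "\<exists>W \<in> Fin C X. prec C Y W \<and> prec C Z W"
    unfolding Fin_def prec_def by blast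
qed

text \<open>
  By universality \<open>X\<close> itself is an amalgam of any two objects of the generated class.
\<close>

lemma Fin_star_AP:
  assumes X: "AB_HO C X"
  shows "star_AP C (Fin C X)"
  unfolding star_AP_def AP_def
proof (intro conjI ballI)
  have XG: "X \<in> generated C (Fin C X)"
    using X by (simp add: generated_def Fin_def AB_HO_def)
  show "\<exists>W \<in> generated C (Fin C X). \<exists>p \<in> Mor C Y W. \<exists>q \<in> Mor C Z W. p \<cdot> u = q \<cdot> v"
    if Y: "Y \<in> generated C (Fin C X)" and Z: "Z \<in> generated C (Fin C X)"
      and u: "u \<in> Mor C A Y" and v: "v \<in> Mor C A Z" for A Y Z u v
    using AB_HO_amalgamation[OF X AB_HO_universal[OF X Y] AB_HO_universal[OF X Z] u v] XG by metis
  show "\<exists>W \<in> generated C (Fin C X). prec C Y W \<and> prec C Z W"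
    if "Y \<in> generated C (Fin C X)" "Z \<in> generated C (Fin C X)" for Y Z
    using AB_HO_universal[OF X] that XG by blast
qed

lemma skeleton_imp_skeletoid_star_AP:
  assumes "skeleton C E"
  shows "skeletoid C E \<and> star_AP C E"
proof -
  obtain X where XO: "X \<in> obj C" and X: "AB_HO C X" and E: "E = Fin C X"
    using assms unfolding skeleton_def by blast
  have "SBP C E"
    unfolding SBP_def E using Upp[OF XO] AB_HO_universal[OF X] generated_subset_obj by blast
  then show ?thesis
    unfolding skeletoid_def E
    using Fin_finitary_structure[OF XO] Fin[OF XO] Fin_AP[OF X] Fin_star_AP[OF X] by blast
qed

end

theorem theorem9p13:
  fixes C :: "('o, 'm, 'u) sized_category" and E :: "'o set"
  assumes "inaccessible_universe TYPE('u)"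
    and "cardinal_category C"
    and "E \<subseteq> obj C"
    and "E \<noteq> {}"
  shows "skeleton C E \<longleftrightarrow> skeletoid C E \<and> star_AP C E"
proof -
  interpret universe_cardinal_category C
    by (intro universe_cardinal_category.intro universe_cardinal_category_axioms.intro assms)
  show ?thesis
    using skeleton_imp_skeletoid_star_AP skeletoid_star_AP_imp_skeleton assms(4) by blast
qed

end
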